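(* Let $L,M,N,R\in\mathbb{N}$, let $p,q\in\mathbb{N}$ be coprime with $N/M=p/q$, and let $\mathbb{S}\subset\mathbb{Z}$ be an $N\mathbb{Z}$-periodic set. The following statements are equivalent. (1) There exists $g=\{g_l\}_{l\in\mathbb{N}_L}\subset\ell^2(\mathbb{S},\mathbb{C}^R)$ such that $\mathcal{G}(g,L,M,N,R)$ is an orthonormal basis for $\ell^2(\mathbb{S},\mathbb{C}^R)$. (2) There exists $g=\{g_l\}_{l\in\mathbb{N}_L}\subset\ell^2(\mathbb{S},\mathbb{C}^R)$ such that $\mathcal{G}(g,L,M,N,R)$ is a Riesz basis for $\ell^2(\mathbb{S},\mathbb{C}^R)$. (3) $R\cdot\operatorname{card}(\mathcal{K}_j)=qL$ for all $j\in\mathbb{N}_{M/q}$.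
   Context: $\mathbb{N}=\{1,2,3,\dots\}$ and $\mathbb{N}_K=\{0,1,\dots,K-1\}$. A nonempty set $\mathbb{S}\subset\mathbb{Z}$ is $N\mathbb{Z}$-periodic if $j+nN\in\mathbb{S}$ for all $j\in\mathbb{S}$, $n\in\mathbb{Z}$. $\ell^2(\mathbb{S})=\{f\in\ell^2(\mathbb{Z}): f(j)=0 \text{ if } j\notin\mathbb{S}\}$, and $\ell^2(\mathbb{S},\mathbb{C}^R)$ is the Hilbert space of $f=(f_1,\dots,f_R)$ with $f_r\in\ell^2(\mathbb{S})$ and inner product $\sum_{r=1}^R\langle f_r,\tilde f_r\rangle$. Operators (componentwise): $E_{m/M}f(j)=e^{2\pi i mj/M}f(j)$, $T_{nN}f(j)=f(j-nN)$. $\mathcal{G}(g,L,M,N,R)=\{E_{m/M}T_{nN}g_l\}_{m\in\mathbb{N}_M,\,n\in\mathbb{Z},\,l\in\mathbb{N}_L}$, regarded as a family indexed by $(m,n,l)$. $\mathcal{K}_j=\{k\in\mathbb{N}_p: j+kM\in\mathbb{S}\}$. *)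

theory Defs
  imports "HOL-Analysis.Analysis"
begin

definition periodic_set :: "nat \<Rightarrow> int set \<Rightarrow> bool" where
  "periodic_set N S \<longleftrightarrow> S \<noteq> {} \<and> (\<forall>j\<in>S. \<forall>n::int. j + n * int N \<in> S)"

definition l2 :: "int set \<Rightarrow> (int \<Rightarrow> complex) set" where
  "l2 S = {f. (\<lambda>j. (cmod (f j))\<^sup>2) summable_on UNIV \<and> (\<forall>j. j \<notin> S \<longrightarrow> f j = 0)}"

text \<open>A vector \<open>(f\<^sub>1, \<dots>, f\<^sub>R)\<close> of sequences is a function of \<open>r\<close> and \<open>j\<close>; the components with
  index outside \<open>{1..R}\<close> are set to zero, so that equality of functions is equality of vectors.\<close>

type_synonym vseq = "nat \<Rightarrow> int \<Rightarrow> complex"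

definition l2v :: "int set \<Rightarrow> nat \<Rightarrow> vseq set" where
  "l2v S R = {f. (\<forall>r\<in>{1..R}. f r \<in> l2 S) \<and> (\<forall>r. r \<notin> {1..R} \<longrightarrow> f r = (\<lambda>_. 0))}"

definition l2v_inner :: "nat \<Rightarrow> vseq \<Rightarrow> vseq \<Rightarrow> complex" where
  "l2v_inner R f h = (\<Sum>r=1..R. \<Sum>\<^sub>\<infinity>j. f r j * cnj (h r j))"

definition l2v_norm :: "nat \<Rightarrow> vseq \<Rightarrow> real" where
  "l2v_norm R f = sqrt (Re (l2v_inner R f f))"

definition lincomb :: "('i \<Rightarrow> complex) \<Rightarrow> ('i \<Rightarrow> vseq) \<Rightarrow> 'i set \<Rightarrow> vseq" where
  "lincomb c e F = (\<lambda>r j. \<Sum>i\<in>F. c i * e i r j)"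

text \<open>Completeness of a family: its finite linear combinations are norm dense in \<open>l2v S R\<close>.\<close>

definition complete_family :: "int set \<Rightarrow> nat \<Rightarrow> 'i set \<Rightarrow> ('i \<Rightarrow> vseq) \<Rightarrow> bool" where
  "complete_family S R I e \<longleftrightarrow>
     (\<forall>f\<in>l2v S R. \<forall>\<epsilon>>0. \<exists>F c. finite F \<and> F \<subseteq> I \<and>
        l2v_norm R (\<lambda>r j. f r j - lincomb c e F r j) < \<epsilon>)"

definition orthonormal_basis :: "int set \<Rightarrow> nat \<Rightarrow> 'i set \<Rightarrow> ('i \<Rightarrow> vseq) \<Rightarrow> bool" where
  "orthonormal_basis S R I e \<longleftrightarrow>
     (\<forall>i\<in>I. e i \<in> l2v S R) \<and>
     (\<forall>i\<in>I. \<forall>k\<in>I. l2v_inner R (e i) (e k) = (if i = k then 1 else 0)) \<and>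
     complete_family S R I e"

definition riesz_sequence :: "int set \<Rightarrow> nat \<Rightarrow> 'i set \<Rightarrow> ('i \<Rightarrow> vseq) \<Rightarrow> bool" where
  "riesz_sequence S R I e \<longleftrightarrow>
     (\<forall>i\<in>I. e i \<in> l2v S R) \<and>
     (\<exists>A>0. \<exists>B>0. \<forall>F c. finite F \<and> F \<subseteq> I \<longrightarrow>
        A * (\<Sum>i\<in>F. (cmod (c i))\<^sup>2) \<le> (l2v_norm R (lincomb c e F))\<^sup>2 \<and>
        (l2v_norm R (lincomb c e F))\<^sup>2 \<le> B * (\<Sum>i\<in>F. (cmod (c i))\<^sup>2))"

definition riesz_basis :: "int set \<Rightarrow> nat \<Rightarrow> 'i set \<Rightarrow> ('i \<Rightarrow> vseq) \<Rightarrow> bool" where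
  "riesz_basis S R I e \<longleftrightarrow> riesz_sequence S R I e \<and> complete_family S R I e"

definition modulation :: "real \<Rightarrow> vseq \<Rightarrow> vseq" where
  "modulation x f = (\<lambda>r j. exp (2 * of_real pi * \<i> * of_real x * of_int j) * f r j)"

definition translation :: "int \<Rightarrow> vseq \<Rightarrow> vseq" where
  "translation k f = (\<lambda>r j. f r (j - k))"

definition gabor_index :: "nat \<Rightarrow> nat \<Rightarrow> (nat \<times> int \<times> nat) set" where
  "gabor_index L M = {..<M} \<times> UNIV \<times> {..<L}"

definition gabor :: "(nat \<Rightarrow> vseq) \<Rightarrow> nat \<Rightarrow> nat \<Rightarrow> nat \<times> int \<times> nat \<Rightarrow> vseq" where
  "gabor g M N = (\<lambda>(m, n, l). modulation (real m / real M) (translation (n * int N) (g l)))"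

definition K_set :: "int set \<Rightarrow> nat \<Rightarrow> nat \<Rightarrow> nat \<Rightarrow> nat set" where
  "K_set S M p j = {k \<in> {..<p}. int j + int k * int M \<in> S}"

text \<open>The quotient \<open>M / q\<close>, which bounds an index range, is an integer, so \<open>M div q\<close> renders it
  without truncation.\<close>

lemma q_dvd_M:
  fixes M N p q :: nat
  assumes "M > 0" "q > 0" "coprime p q" "real N / real M = real p / real q"
  shows "q dvd M"
proof -
  have "real (N * q) = real (p * M)"
    using assms by (simp add: field_simps)
  then have "N * q = p * M"
    by (simp only: of_nat_eq_iff)
  then have "q dvd p * M"
    by (metis dvd_triv_right)
  then show ?thesis
    using assms(3) by (simp add: coprime_commute coprime_dvd_mult_right_iff)
qed

end

(* (2) => (3) computes the trace of the identity locally.  Let phi_(m,n,l) be the biorthogonal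
   functionals of a Riesz basis, delta_(j,r) the unit vectors, d = M / q = N / p, and
   w(j) = sum over l and r of phi_(0,0,l)(delta_(j,r)) * g_l(r, j).  Expanding delta_(j,r) in the basis
   and using covariance under time-frequency shifts gives M * (sum over n of w(j - n N)) = R * 1_S(j).
   Restriction to a residue class mod d is an average of modulations E_(mq/M), so biorthogonality
   makes w sum to L / d over each class.  A class is the disjoint union of the p orbits
   a + k M + N Z, k < p; comparing both sums gives R * card K_a = M * L / d = q L.
   For (3) => (1), bijections N_q x N_L -> K_a x {1..R} yield supports G_l that are transversals of
   Z / M and whose translates by N Z tile S x {1..R}; the normalised indicators of the G_l generate an
   orthonormal basis by orthogonality of the characters of Z / M. *)
theory Submission
  imports Defs
begin


text \<open>The identity has no finite trace on an infinite-dimensional space, so its trace is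
  spread over Z as a density and compared on sets where it can be summed in two ways. The modulus d
  is the gcd of M and N: a class modulo D is a union of orbits of N Z when D divides N, and its
  indicator is a combination of the characters of Z / M when D divides M. The dual Riesz basis never
  appears as a family of vectors. Its members are bounded functionals, obtained as limits of finite
  expansions, and their values on unit vectors replace the entries of the dual generators. All
  series converge unconditionally, so the density may be summed class by class or orbit by orbit. In
  the converse, the supports consist of points a + k M + u N with a < d, k < p, u < q. The term k M
  does not change the residue modulo M, and u N does not change the orbit under N Z. Being a
  transversal therefore constrains only (a, u), and k is free to be dictated by the bijections. That
  (1) implies (2) is the finite Parseval identity.\<close>

section \<open>The norm of \<open>l\<^sup>2(S, C\<^sup>R)\<close>\<close>

text \<open>Otherwise the simplifier turns the index range \<open>{1..R}\<close> into \<open>{Suc 0..R}\<close>.\<close>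

declare One_nat_def [simp del]

text \<open>No summability is assumed: both families are summable or neither is, and in the latter
  case both sums take the default value 0.\<close>

lemma infsum_complex_of_real: "(\<Sum>\<^sub>\<infinity>x\<in>A. complex_of_real (f x)) = of_real (\<Sum>\<^sub>\<infinity>x\<in>A. f x)"
proof (rule infsum_bounded_linear_strong)
  show "(\<lambda>x. complex_of_real (f x)) summable_on A \<longleftrightarrow> f summable_on A"
    using summable_on_Re[of "\<lambda>x. complex_of_real (f x)" A] by (auto intro: summable_on_of_real)
qed (rule bounded_linear_of_real)

lemma has_sum_sum:
  fixes f :: "'i \<Rightarrow> 'a \<Rightarrow> 'b::topological_comm_monoid_add"
  assumes "\<And>i. i \<in> I \<Longrightarrow> (f i has_sum s i) A"
  shows "((\<lambda>x. \<Sum>i\<in>I. f i x) has_sum (\<Sum>i\<in>I. s i)) A"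
  using assms by (induction I rule: infinite_finite_induct) (auto intro: has_sum_add)

text \<open>These hold for every \<open>f\<close>, not only on \<open>l2v S R\<close>, because a
  component that is not square summable contributes the default 0 to both sums.\<close>

lemma
  shows l2v_norm_sq: "(l2v_norm R f)\<^sup>2 = (\<Sum>r=1..R. \<Sum>\<^sub>\<infinity>j. (cmod (f r j))\<^sup>2)"
    and l2v_norm_nonneg [simp]: "0 \<le> l2v_norm R f"
proof -
  have "Re (l2v_inner R f f) = (\<Sum>r=1..R. \<Sum>\<^sub>\<infinity>j. (cmod (f r j))\<^sup>2)"
    unfolding l2v_inner_def complex_norm_square[symmetric] infsum_complex_of_real by simp
  moreover have "\<dots> \<ge> 0"
    by (intro sum_nonneg infsum_nonneg) simp
  ultimately show "(l2v_norm R f)\<^sup>2 = (\<Sum>r=1..R. \<Sum>\<^sub>\<infinity>j. (cmod (f r j))\<^sup>2)" "0 \<le> l2v_norm R f"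
    unfolding l2v_norm_def by simp_all
qed

lemma l2v_has_sum:
  assumes "f \<in> l2v S R"
  shows "((\<lambda>j. \<Sum>r=1..R. (cmod (f r j))\<^sup>2) has_sum (l2v_norm R f)\<^sup>2) UNIV"
  unfolding l2v_norm_sq using assms
  by (intro has_sum_sum has_sum_infsum) (auto simp: l2v_def l2_def)

lemma l2vI:
  assumes "(\<lambda>j. \<Sum>r=1..R. (cmod (f r j))\<^sup>2) summable_on UNIV"
    and "\<And>r j. r \<in> {1..R} \<Longrightarrow> j \<notin> S \<Longrightarrow> f r j = 0"
    and "\<And>r j. r \<notin> {1..R} \<Longrightarrow> f r j = 0"
  shows "f \<in> l2v S R"
proof -
  have "(\<lambda>j. (cmod (f r j))\<^sup>2) summable_on UNIV" if "r \<in> {1..R}" for r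
  proof (rule summable_on_comparison_test[OF assms(1)])
    show "(cmod (f r j))\<^sup>2 \<le> (\<Sum>r=1..R. (cmod (f r j))\<^sup>2)" for j
      using that by (intro member_le_sum) auto
  qed auto
  with assms show ?thesis
    by (auto simp: l2v_def l2_def)
qed

lemma l2v_zero: "f \<in> l2v S R \<Longrightarrow> r \<notin> {1..R} \<or> j \<notin> S \<Longrightarrow> f r j = 0"
  by (cases "r \<in> {1..R}") (auto simp: l2v_def l2_def)

lemma sum_le_l2v_norm:
  assumes "f \<in> l2v S R" "finite J"
  shows "(\<Sum>j\<in>J. \<Sum>r=1..R. (cmod (f r j))\<^sup>2) \<le> (l2v_norm R f)\<^sup>2"
  using finite_sum_le_has_sum[OF l2v_has_sum[OF assms(1)] assms(2)] by (simp add: sum_nonneg)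

text \<open>Membership and norm bound follow together from bounds on finite windows. This reduces
  the norm inequalities below to inequalities between finite sums.\<close>

lemma sum_bounded_in_l2v:
  assumes "\<And>J. finite J \<Longrightarrow> (\<Sum>j\<in>J. \<Sum>r=1..R. (cmod (f r j))\<^sup>2) \<le> t\<^sup>2"
    and "\<And>r j. r \<notin> {1..R} \<or> j \<notin> S \<Longrightarrow> f r j = 0" and "t \<ge> 0"
  shows "f \<in> l2v S R" "l2v_norm R f \<le> t"
proof -
  have "(\<lambda>j. \<Sum>r=1..R. (cmod (f r j))\<^sup>2) summable_on UNIV"
    by (rule nonneg_bdd_above_summable_on)
      (auto intro!: sum_nonneg bdd_aboveI2[where M = "t\<^sup>2"] dest: assms(1))
  with assms(2) show f: "f \<in> l2v S R"
    by (intro l2vI) auto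
  have "(l2v_norm R f)\<^sup>2 \<le> t\<^sup>2"
    by (rule has_sum_le_finite_sums[OF l2v_has_sum[OF f]]) (auto intro: assms(1))
  then show "l2v_norm R f \<le> t"
    using assms(3) power2_le_imp_le by blast
qed

lemma L2_set_l2v:
  "sqrt (\<Sum>j\<in>J. \<Sum>r=1..R. (cmod (f r j))\<^sup>2) = L2_set (\<lambda>(j,r). cmod (f r j)) (J \<times> {1..R})"
  unfolding L2_set_def sum.cartesian_product by (simp add: case_prod_unfold)

text \<open>Minkowski's inequality, taken from \<open>L2_set\<close> on each finite window. The form
  a f + h covers sums, differences and multiples at once.\<close>

lemma
  assumes f: "f \<in> l2v S R" and h: "h \<in> l2v S R"
  shows l2v_lin: "(\<lambda>r j. a * f r j + h r j) \<in> l2v S R"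
    and l2v_norm_lin: "l2v_norm R (\<lambda>r j. a * f r j + h r j) \<le> cmod a * l2v_norm R f + l2v_norm R h"
proof -
  have fin: "(\<Sum>j\<in>J. \<Sum>r=1..R. (cmod (a * f r j + h r j))\<^sup>2) \<le> (cmod a * l2v_norm R f + l2v_norm R h)\<^sup>2"
    if J: "finite J" for J
  proof -
    let ?N = "\<lambda>f. L2_set (\<lambda>(j,r). cmod (f r j)) (J \<times> {1..R})"
    have "?N f \<le> l2v_norm R f" "?N h \<le> l2v_norm R h"
      using sum_le_l2v_norm[OF f J] sum_le_l2v_norm[OF h J]
      unfolding L2_set_l2v[symmetric] by (simp_all add: real_le_lsqrt)
    moreover have "?N (\<lambda>r j. a * f r j + h r j) \<le> L2_set (\<lambda>x. cmod a * (case x of (j,r) \<Rightarrow> cmod (f r j)) + (case x of (j,r) \<Rightarrow> cmod (h r j))) (J \<times> {1..R})"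
      by (rule L2_set_mono) (auto intro: order_trans[OF norm_triangle_ineq] simp: norm_mult)
    moreover have "\<dots> \<le> L2_set (\<lambda>x. cmod a * (case x of (j,r) \<Rightarrow> cmod (f r j))) (J \<times> {1..R}) + ?N h"
      by (rule L2_set_triangle_ineq)
    moreover have "L2_set (\<lambda>x. cmod a * (case x of (j,r) \<Rightarrow> cmod (f r j))) (J \<times> {1..R}) = cmod a * ?N f"
      by (simp add: L2_set_right_distrib)
    moreover have "cmod a * ?N f \<le> cmod a * l2v_norm R f"
      using calculation(1) by (rule mult_left_mono) simp
    ultimately have "?N (\<lambda>r j. a * f r j + h r j) \<le> cmod a * l2v_norm R f + l2v_norm R h"
      by linarith
    then have "sqrt (\<Sum>j\<in>J. \<Sum>r=1..R. (cmod (a * f r j + h r j))\<^sup>2) \<le> cmod a * l2v_norm R f + l2v_norm R h"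
      by (simp only: L2_set_l2v)
    then show ?thesis
      by (rule sqrt_le_D)
  qed
  have z: "a * f r j + h r j = 0" if "r \<notin> {1..R} \<or> j \<notin> S" for r j
    using l2v_zero[OF f that] l2v_zero[OF h that] by simp
  have nn: "cmod a * l2v_norm R f + l2v_norm R h \<ge> 0"
    by simp
  show "(\<lambda>r j. a * f r j + h r j) \<in> l2v S R"
    by (rule sum_bounded_in_l2v(1)[where f = "\<lambda>r j. a * f r j + h r j", OF fin z nn])
  show "l2v_norm R (\<lambda>r j. a * f r j + h r j) \<le> cmod a * l2v_norm R f + l2v_norm R h"
    by (rule sum_bounded_in_l2v(2)[where f = "\<lambda>r j. a * f r j + h r j", OF fin z nn])
qed

lemma zero_in_l2v [simp]: "(\<lambda>_ _. 0) \<in> l2v S R"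
  and l2v_norm_zero [simp]: "l2v_norm R (\<lambda>_ _. 0) = 0"
  by (simp_all add: l2v_def l2_def l2v_norm_def l2v_inner_def)

lemma
  assumes "f \<in> l2v S R" "h \<in> l2v S R"
  shows l2v_diff: "(\<lambda>r j. f r j - h r j) \<in> l2v S R"
    and l2v_norm_diff: "l2v_norm R (\<lambda>r j. f r j - h r j) \<le> l2v_norm R f + l2v_norm R h"
  using l2v_lin[OF assms(2,1), of "-1"] l2v_norm_lin[OF assms(2,1), of "-1"] by simp_all

lemma l2v_lincomb:
  assumes "finite F" "\<And>i. i \<in> F \<Longrightarrow> e i \<in> l2v S R"
  shows "lincomb c e F \<in> l2v S R"
  using assms
proof (induction F)
  case (insert i F)
  then show ?case
    using l2v_lin[of "e i" S R "lincomb c e F" "c i"] by (simp add: lincomb_def)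
qed (simp add: lincomb_def)

text \<open>Point evaluations are contractions; this later turns norm approximation by finite
  expansions into pointwise convergence.\<close>

lemma norm_le_l2v_norm:
  assumes "f \<in> l2v S R" "r \<in> {1..R}"
  shows "cmod (f r j) \<le> l2v_norm R f"
proof -
  have "(cmod (f r j))\<^sup>2 \<le> (\<Sum>r=1..R. (cmod (f r j))\<^sup>2)"
    using assms(2) by (intro member_le_sum) auto
  also have "\<dots> \<le> (l2v_norm R f)\<^sup>2"
    using sum_le_l2v_norm[OF assms(1), of "{j}"] by simp
  finally show ?thesis
    by (rule power2_le_imp_le) simp
qed

lemma l2v_restrict:
  assumes f: "f \<in> l2v S R"
  shows "(\<lambda>r j. if j \<in> J then f r j else 0) \<in> l2v S R"
proof (rule l2vI)
  show "(\<lambda>j. \<Sum>r=1..R. (cmod (if j \<in> J then f r j else 0))\<^sup>2) summable_on UNIV"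
    by (rule summable_on_comparison_test[OF has_sum_imp_summable[OF l2v_has_sum[OF f]]])
      (auto intro!: sum_mono sum_nonneg)
qed (use l2v_zero[OF f] in auto)

text \<open>The bound is given for all finite \<open>J'\<close> above \<open>J\<close>, since
  convergence along the net of finite sets is what \<open>bounded_functional_has_sum\<close> has to
  prove.\<close>

lemma l2v_restrict_approx:
  assumes f: "f \<in> l2v S R" and e: "\<epsilon> > 0"
  obtains J where "finite J"
    "\<And>J'. finite J' \<Longrightarrow> J \<subseteq> J' \<Longrightarrow> l2v_norm R (\<lambda>r j. f r j - (if j \<in> J' then f r j else 0)) < \<epsilon>"
proof -
  let ?q = "\<lambda>j. \<Sum>r=1..R. (cmod (f r j))\<^sup>2"
  \<comment> \<open>Halving leaves room for the strict inequality, because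
    \<open>sum_bounded_in_l2v\<close> only yields a weak one.\<close>
  have e2: "\<epsilon>\<^sup>2 / 2 > 0"
    using e by simp
  obtain J where J: "finite J" "\<And>J'. finite J' \<Longrightarrow> J \<subseteq> J' \<Longrightarrow> dist (sum ?q J') ((l2v_norm R f)\<^sup>2) < \<epsilon>\<^sup>2 / 2"
    using l2v_has_sum[OF f] e2
    unfolding has_sum_def tendsto_iff eventually_finite_subsets_at_top by (metis subset_UNIV)
  show ?thesis
  proof (rule that[OF J(1)])
    fix J' assume J': "finite J'" "J \<subseteq> J'"
    let ?g = "\<lambda>r j. f r j - (if j \<in> J' then f r j else 0)"
    have "(\<Sum>j\<in>A. \<Sum>r=1..R. (cmod (?g r j))\<^sup>2) \<le> (sqrt (\<epsilon>\<^sup>2 / 2))\<^sup>2" if A: "finite A" for A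
    proof -
      have "(\<Sum>j\<in>A. \<Sum>r=1..R. (cmod (?g r j))\<^sup>2) = sum ?q (A - J')"
        using A by (intro sum.mono_neutral_cong_right) auto
      \<comment> \<open>The energy outside \<open>J'\<close> is a difference of two partial sums,
        the larger of which is at most the squared norm.\<close>
      also have "\<dots> = sum ?q (A \<union> J') - sum ?q J'"
        using A J'(1) by (simp add: sum_diff[symmetric] Un_Diff)
      also have "\<dots> \<le> (l2v_norm R f)\<^sup>2 - sum ?q J'"
        using sum_le_l2v_norm[OF f, of "A \<union> J'"] A J'(1) by simp
      also have "\<dots> \<le> \<epsilon>\<^sup>2 / 2"
        using J(2)[OF J'] unfolding dist_real_def by linarith
      finally show ?thesis
        by simp
    qed
    then have "l2v_norm R ?g \<le> sqrt (\<epsilon>\<^sup>2 / 2)"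
      by (rule sum_bounded_in_l2v(2)) (use l2v_zero[OF f] in auto)
    also have "\<dots> < sqrt (\<epsilon>\<^sup>2)"
      using e by (simp del: real_sqrt_abs)
    also have "\<dots> = \<epsilon>"
      using e by simp
    finally show "l2v_norm R ?g < \<epsilon>" .
  qed
qed


section \<open>Bounded functionals and Riesz coefficients\<close>

text \<open>These functionals stand in for the dual basis. As \<open>\<phi>\<close> is a total
  function on \<open>vseq\<close>, linearity and boundedness are demanded on \<open>l2v S R\<close>
  only.\<close>

definition bounded_functional :: "int set \<Rightarrow> nat \<Rightarrow> (vseq \<Rightarrow> complex) \<Rightarrow> bool" where
  "bounded_functional S R \<phi> \<longleftrightarrow>
     (\<forall>f\<in>l2v S R. \<forall>h\<in>l2v S R. \<forall>a. \<phi> (\<lambda>r j. a * f r j + h r j) = a * \<phi> f + \<phi> h) \<and>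
     (\<exists>C\<ge>0. \<forall>f\<in>l2v S R. cmod (\<phi> f) \<le> C * l2v_norm R f)"

lemma bounded_functional_lincomb:
  assumes \<phi>: "bounded_functional S R \<phi>" and F: "finite F" "\<And>i. i \<in> F \<Longrightarrow> e i \<in> l2v S R"
  shows "\<phi> (lincomb c e F) = (\<Sum>i\<in>F. c i * \<phi> (e i))"
  using F
proof (induction F)
  case empty
  have "\<phi> (\<lambda>r j. a * f r j + h r j) = a * \<phi> f + \<phi> h" if "f \<in> l2v S R" "h \<in> l2v S R" for a f h
    using \<phi> that unfolding bounded_functional_def by blast
  from this[OF zero_in_l2v zero_in_l2v, of 1] have "\<phi> (\<lambda>_ _. 0) = 0"
    by simp
  then show ?case
    by (simp add: lincomb_def)
next
  case (insert i F)
  have "lincomb c e (insert i F) = (\<lambda>r j. c i * e i r j + lincomb c e F r j)"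
    using insert.hyps by (simp add: lincomb_def)
  moreover have "lincomb c e F \<in> l2v S R"
    using insert by (intro l2v_lincomb) auto
  ultimately show ?case
    using insert \<phi> unfolding bounded_functional_def by simp
qed

lemma bounded_functional_scale:
  assumes \<phi>: "bounded_functional S R \<phi>" and f: "f \<in> l2v S R"
  shows "\<phi> (\<lambda>r j. a * f r j) = a * \<phi> f"
  using bounded_functional_lincomb[OF \<phi>, of "{()}" "\<lambda>_. f" "\<lambda>_. a"] f by (simp add: lincomb_def)

lemma bounded_functional_diff:
  assumes \<phi>: "bounded_functional S R \<phi>" and f: "f \<in> l2v S R" and h: "h \<in> l2v S R"
  shows "\<phi> (\<lambda>r j. f r j - h r j) = \<phi> f - \<phi> h"
proof -
  have "\<phi> (\<lambda>r j. (- 1) * h r j + f r j) = (- 1) * \<phi> h + \<phi> f"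
    using \<phi> f h unfolding bounded_functional_def by blast
  then show ?thesis
    by simp
qed

lemma complete_familyE:
  assumes "complete_family S R I e" "f \<in> l2v S R" "\<epsilon> > 0"
  obtains F c where "finite F" "F \<subseteq> I" "l2v_norm R (\<lambda>r j. f r j - lincomb c e F r j) < \<epsilon>"
  using bspec[OF assms(1)[unfolded complete_family_def] assms(2), rule_format, OF assms(3)] by blast

text \<open>By linearity the two functionals agree on finite combinations, which are dense, and both
  are continuous.\<close>

lemma bounded_functional_unique:
  assumes \<phi>: "bounded_functional S R \<phi>" and \<psi>: "bounded_functional S R \<psi>"
    and e: "\<And>i. i \<in> I \<Longrightarrow> e i \<in> l2v S R" and cpl: "complete_family S R I e"
    and eq: "\<And>i. i \<in> I \<Longrightarrow> \<phi> (e i) = \<psi> (e i)" and f: "f \<in> l2v S R"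
  shows "\<phi> f = \<psi> f"
proof -
  obtain C where C: "C \<ge> 0" "\<And>f. f \<in> l2v S R \<Longrightarrow> cmod (\<phi> f) \<le> C * l2v_norm R f"
    using \<phi> unfolding bounded_functional_def by blast
  obtain D where D: "D \<ge> 0" "\<And>f. f \<in> l2v S R \<Longrightarrow> cmod (\<psi> f) \<le> D * l2v_norm R f"
    using \<psi> unfolding bounded_functional_def by blast
  have "cmod (\<phi> f - \<psi> f) \<le> 0 + \<epsilon>" if "\<epsilon> > 0" for \<epsilon>
  proof -
    \<comment> \<open>The added 1 keeps the denominator positive when both bounds are 0.\<close>
    define \<eta> where "\<eta> = \<epsilon> / (C + D + 1)"
    have "\<eta> > 0"
      using that C(1) D(1) by (simp add: \<eta>_def)
    from complete_familyE[OF cpl f this] obtain F c where F: "finite F" "F \<subseteq> I"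
      and lt: "l2v_norm R (\<lambda>r j. f r j - lincomb c e F r j) < \<eta>"
      by blast
    let ?h = "lincomb c e F"
    have h: "?h \<in> l2v S R"
      using F e by (intro l2v_lincomb) auto
    have hh: "\<phi> ?h = \<psi> ?h"
    proof -
      have eF: "e i \<in> l2v S R" if "i \<in> F" for i
        using that F e by auto
      have "(\<Sum>i\<in>F. c i * \<phi> (e i)) = (\<Sum>i\<in>F. c i * \<psi> (e i))"
        using F eq by (intro sum.cong) auto
      then show ?thesis
        by (simp add: bounded_functional_lincomb[OF \<phi> F(1) eF] bounded_functional_lincomb[OF \<psi> F(1) eF])
    qed
    have "cmod (\<phi> f - \<psi> f) = cmod (\<phi> (\<lambda>r j. f r j - ?h r j) - \<psi> (\<lambda>r j. f r j - ?h r j))"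
      using bounded_functional_diff[OF \<phi> f h] bounded_functional_diff[OF \<psi> f h] hh by simp
    also have "\<dots> \<le> cmod (\<phi> (\<lambda>r j. f r j - ?h r j)) + cmod (\<psi> (\<lambda>r j. f r j - ?h r j))"
      by (rule norm_triangle_ineq4)
    also have "\<dots> \<le> (C + D) * l2v_norm R (\<lambda>r j. f r j - ?h r j)"
      using C(2)[OF l2v_diff[OF f h]] D(2)[OF l2v_diff[OF f h]] by (simp add: distrib_right)
    also have "\<dots> \<le> (C + D + 1) * \<eta>"
      using C(1) D(1) lt by (intro mult_mono) auto
    also have "\<dots> = \<epsilon>"
      using C(1) D(1) by (simp add: \<eta>_def)
    finally show ?thesis
      by simp
  qed
  then have "cmod (\<phi> f - \<psi> f) \<le> 0"
    by (rule field_le_epsilon)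
  then show ?thesis
    by simp
qed

text \<open>The condition \<open>j \<in> S\<close> makes this the zero vector off \<open>S\<close>,
  so it belongs to the space for every \<open>j\<close> and sums over \<open>j\<close> may range
  over all of Z.\<close>

definition unit_vseq :: "int set \<Rightarrow> int \<times> nat \<Rightarrow> vseq" where
  "unit_vseq S = (\<lambda>(j, r) r' j'. if r' = r \<and> j' = j \<and> j \<in> S then 1 else 0)"

lemma unit_vseq_in_l2v:
  assumes "r \<in> {1..R}"
  shows "unit_vseq S (j, r) \<in> l2v S R"
proof (rule l2vI)
  show "(\<lambda>i. \<Sum>s=1..R. (cmod (unit_vseq S (j, r) s i))\<^sup>2) summable_on UNIV"
  proof (rule finite_nonzero_values_imp_summable_on, rule finite_subset)
    have "(\<Sum>s=1..R. (cmod (unit_vseq S (j, r) s i))\<^sup>2) = 0" if "i \<noteq> j" for i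
      using that by (simp add: unit_vseq_def)
    then show "{i \<in> UNIV. (\<Sum>s=1..R. (cmod (unit_vseq S (j, r) s i))\<^sup>2) \<noteq> 0} \<subseteq> {j}"
      by blast
  qed simp
qed (use assms in \<open>auto simp: unit_vseq_def\<close>)

lemma restrict_eq_lincomb_unit_vseq:
  assumes "f \<in> l2v S R" "finite J"
  shows "(\<lambda>r j. if j \<in> J then f r j else 0) = lincomb (\<lambda>(j, r). f r j) (unit_vseq S) (J \<times> {1..R})"
proof (intro ext)
  fix r j
  have "lincomb (\<lambda>(j, r). f r j) (unit_vseq S) (J \<times> {1..R}) r j =
      (\<Sum>x\<in>J \<times> {1..R}. if x = (j, r) then (if j \<in> S then f r j else 0) else 0)"
    unfolding lincomb_def by (intro sum.cong) (auto simp: unit_vseq_def split: if_splits)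
  also have "\<dots> = (if j \<in> J then f r j else 0)"
    using assms(2) l2v_zero[OF assms(1), of r j] by (subst sum.delta) auto
  finally show "(if j \<in> J then f r j else 0) = lincomb (\<lambda>(j, r). f r j) (unit_vseq S) (J \<times> {1..R}) r j"
    by simp
qed

text \<open>Restrictions of \<open>f\<close> to finite windows converge to \<open>f\<close> in norm
  and \<open>\<phi>\<close> is continuous. This is the Riesz representation in coordinates: the
  values on unit vectors are the conjugated entries of the representing vector.\<close>

lemma bounded_functional_has_sum:
  assumes \<phi>: "bounded_functional S R \<phi>" and f: "f \<in> l2v S R"
  shows "((\<lambda>j. \<Sum>r=1..R. f r j * \<phi> (unit_vseq S (j, r))) has_sum \<phi> f) UNIV"
  unfolding has_sum_def tendsto_iff eventually_finite_subsets_at_top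
proof (intro allI impI)
  fix \<epsilon> :: real assume "\<epsilon> > 0"
  obtain C where C: "C \<ge> 0" "\<And>f. f \<in> l2v S R \<Longrightarrow> cmod (\<phi> f) \<le> C * l2v_norm R f"
    using \<phi> unfolding bounded_functional_def by blast
  have "\<epsilon> / (C + 1) > 0"
    using \<open>\<epsilon> > 0\<close> C(1) by simp
  from l2v_restrict_approx[OF f this] obtain J where J: "finite J"
    "\<And>J'. finite J' \<Longrightarrow> J \<subseteq> J' \<Longrightarrow> l2v_norm R (\<lambda>r j. f r j - (if j \<in> J' then f r j else 0)) < \<epsilon> / (C + 1)"
    by blast
  have "dist (\<Sum>j\<in>J'. \<Sum>r=1..R. f r j * \<phi> (unit_vseq S (j, r))) (\<phi> f) < \<epsilon>"
    if J': "finite J'" "J \<subseteq> J'" for J'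
  proof -
    let ?h = "\<lambda>r j. if j \<in> J' then f r j else 0"
    have h: "?h \<in> l2v S R"
      by (rule l2v_restrict[OF f])
    have "\<phi> ?h = (\<Sum>j\<in>J'. \<Sum>r=1..R. f r j * \<phi> (unit_vseq S (j, r)))"
      unfolding restrict_eq_lincomb_unit_vseq[OF f J'(1)]
      by (subst bounded_functional_lincomb[OF \<phi>])
        (use J' in \<open>auto simp: sum.cartesian_product case_prod_unfold intro!: unit_vseq_in_l2v\<close>)
    then have "dist (\<Sum>j\<in>J'. \<Sum>r=1..R. f r j * \<phi> (unit_vseq S (j, r))) (\<phi> f) = cmod (\<phi> (\<lambda>r j. f r j - ?h r j))"
      by (simp add: bounded_functional_diff[OF \<phi> f h] dist_norm norm_minus_commute)
    also have "\<dots> \<le> C * l2v_norm R (\<lambda>r j. f r j - ?h r j)"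
      by (intro C(2) l2v_diff f h)
    also have "\<dots> \<le> C * (\<epsilon> / (C + 1))"
      using J(2)[OF J'] C(1) by (intro mult_left_mono) auto
    also have "\<dots> < \<epsilon>"
      using C(1) \<open>\<epsilon> > 0\<close> by (simp add: field_simps)
    finally show ?thesis .
  qed
  with J(1) show "\<exists>X. finite X \<and> X \<subseteq> UNIV \<and> (\<forall>Y. finite Y \<and> X \<subseteq> Y \<and> Y \<subseteq> UNIV \<longrightarrow>
      dist (\<Sum>j\<in>Y. \<Sum>r=1..R. f r j * \<phi> (unit_vseq S (j, r))) (\<phi> f) < \<epsilon>)"
    by blast
qed

section \<open>Coefficient functionals of a Riesz basis, by closure of the finite expansions\<close>

lemma lincomb_extend:
  assumes "finite F'" "F \<subseteq> F'" "\<And>i. i \<notin> F \<Longrightarrow> b i = 0"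
  shows "lincomb b e F' = lincomb b e F"
  unfolding lincomb_def using assms by (intro ext sum.mono_neutral_right) auto

lemma lincomb_lin:
  assumes "finite F" "finite F'" "\<And>i. i \<notin> F \<Longrightarrow> b i = 0" "\<And>i. i \<notin> F' \<Longrightarrow> b' i = 0"
  shows "lincomb (\<lambda>i. a * b i + b' i) e (F \<union> F') = (\<lambda>r j. a * lincomb b e F r j + lincomb b' e F' r j)"
proof -
  have "lincomb b e (F \<union> F') = lincomb b e F" "lincomb b' e (F \<union> F') = lincomb b' e F'"
    by (rule lincomb_extend; use assms in auto)+
  moreover have "lincomb (\<lambda>i. a * b i + b' i) e (F \<union> F') =
      (\<lambda>r j. a * lincomb b e (F \<union> F') r j + lincomb b' e (F \<union> F') r j)"
    by (simp add: lincomb_def distrib_right sum.distrib sum_distrib_left mult.assoc)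
  ultimately show ?thesis
    by simp
qed

locale riesz_family =
  fixes S :: "int set" and R :: nat and I :: "'i set" and e :: "'i \<Rightarrow> vseq" and A B :: real
  assumes e: "\<And>i. i \<in> I \<Longrightarrow> e i \<in> l2v S R"
    and A: "A > 0" and B: "B > 0"
    and lower: "\<And>F c. finite F \<Longrightarrow> F \<subseteq> I \<Longrightarrow>
      A * (\<Sum>i\<in>F. (cmod (c i))\<^sup>2) \<le> (l2v_norm R (lincomb c e F))\<^sup>2"
    and upper: "\<And>F c. finite F \<Longrightarrow> F \<subseteq> I \<Longrightarrow>
      (l2v_norm R (lincomb c e F))\<^sup>2 \<le> B * (\<Sum>i\<in>F. (cmod (c i))\<^sup>2)"
    and complete: "complete_family S R I e"
begin

text \<open>Coefficients vanish off \<open>F\<close>, so families with different supports can be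
  subtracted pointwise and compared on any finite set.\<close>

definition fincoeff :: "'i set \<Rightarrow> ('i \<Rightarrow> complex) \<Rightarrow> bool" where
  "fincoeff F b \<longleftrightarrow> finite F \<and> F \<subseteq> I \<and> (\<forall>i. i \<notin> F \<longrightarrow> b i = 0)"

text \<open>\<open>c\<close> is the coefficient family of \<open>f\<close>: the pair lies in the closure of the finite expansions.\<close>

definition represents :: "vseq \<Rightarrow> ('i \<Rightarrow> complex) \<Rightarrow> bool" where
  "represents f c \<longleftrightarrow> (\<forall>\<epsilon>>0. \<exists>F b. fincoeff F b \<and>
     l2v_norm R (\<lambda>r j. f r j - lincomb b e F r j) \<le> \<epsilon> \<and>
     (\<forall>G. finite G \<longrightarrow> L2_set (\<lambda>i. cmod (c i - b i)) G \<le> \<epsilon>))"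

lemma lincomb_in_l2v: "finite F \<Longrightarrow> F \<subseteq> I \<Longrightarrow> lincomb b e F \<in> l2v S R"
  by (rule l2v_lincomb) (auto intro: e)

text \<open>The lower Riesz inequality read as continuity of the coefficient map. \<open>G\<close>
  need not be the support, which makes the estimate uniform over all finite sets.\<close>

lemma lower_L2_set:
  assumes "fincoeff F b" "finite G"
  shows "L2_set (\<lambda>i. cmod (b i)) G \<le> l2v_norm R (lincomb b e F) / sqrt A"
proof -
  have F: "finite F" "F \<subseteq> I" and z: "\<And>i. i \<notin> F \<Longrightarrow> b i = 0"
    using assms(1) by (auto simp: fincoeff_def)
  have "(\<Sum>i\<in>G. (cmod (b i))\<^sup>2) = (\<Sum>i\<in>G \<inter> F. (cmod (b i))\<^sup>2)"
    using assms(2) z by (intro sum.mono_neutral_right) auto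
  also have "\<dots> \<le> (\<Sum>i\<in>F. (cmod (b i))\<^sup>2)"
    using F by (intro sum_mono2) auto
  finally have "A * (\<Sum>i\<in>G. (cmod (b i))\<^sup>2) \<le> A * (\<Sum>i\<in>F. (cmod (b i))\<^sup>2)"
    using A by simp
  also have "\<dots> \<le> (l2v_norm R (lincomb b e F))\<^sup>2"
    by (rule lower[OF F])
  finally have "sqrt (A * (\<Sum>i\<in>G. (cmod (b i))\<^sup>2)) \<le> l2v_norm R (lincomb b e F)"
    by (simp add: real_le_lsqrt)
  then show ?thesis
    using A by (simp add: L2_set_def real_sqrt_mult field_simps)
qed

lemma upper_L2_set:
  assumes "finite G" "G \<subseteq> I"
  shows "l2v_norm R (lincomb b e G) \<le> sqrt B * L2_set (\<lambda>i. cmod (b i)) G"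
  using real_le_rsqrt[OF upper[OF assms, of b]] by (simp add: L2_set_def real_sqrt_mult)

lemma represents_bound:
  assumes rep: "represents f c" and f: "f \<in> l2v S R"
  shows "cmod (c i) \<le> l2v_norm R f / sqrt A"
proof -
  have "cmod (c i) \<le> l2v_norm R f / sqrt A + \<epsilon>" if "\<epsilon> > 0" for \<epsilon>
  proof -
    \<comment> \<open>Two errors add up: \<open>\<eta>\<close> between the coefficients, and
      \<open>\<eta> / sqrt A\<close> from the norm of the approximating combination.\<close>
    define \<eta> where "\<eta> = \<epsilon> / (1 + 1 / sqrt A)"
    have pos: "1 + 1 / sqrt A > 0"
      using A by (simp add: add_pos_pos)
    then have "\<eta> > 0"
      using that by (simp add: \<eta>_def)
    then obtain F b where b: "fincoeff F b" and
      n: "l2v_norm R (\<lambda>r j. f r j - lincomb b e F r j) \<le> \<eta>" and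
      l: "\<And>G. finite G \<Longrightarrow> L2_set (\<lambda>i. cmod (c i - b i)) G \<le> \<eta>"
      using rep unfolding represents_def by blast
    have F: "lincomb b e F \<in> l2v S R"
      using b by (auto simp: fincoeff_def intro: lincomb_in_l2v)
    have "cmod (b i) \<le> l2v_norm R (lincomb b e F) / sqrt A"
      using lower_L2_set[OF b, of "{i}"] by simp
    also have "l2v_norm R (lincomb b e F) \<le> l2v_norm R f + \<eta>"
      using l2v_norm_diff[OF f l2v_diff[OF f F]] n by simp
    finally have "cmod (b i) \<le> (l2v_norm R f + \<eta>) / sqrt A"
      using A by (simp add: divide_right_mono)
    moreover have "cmod (c i - b i) \<le> \<eta>"
      using l[of "{i}"] by simp
    moreover have "cmod (c i) \<le> cmod (b i) + cmod (c i - b i)"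
      by (rule norm_triangle_sub)
    ultimately have "cmod (c i) \<le> l2v_norm R f / sqrt A + \<eta> * (1 + 1 / sqrt A)"
      by (simp add: add_divide_distrib distrib_left)
    also have "\<eta> * (1 + 1 / sqrt A) = \<epsilon>"
      using pos by (simp add: \<eta>_def)
    finally show ?thesis .
  qed
  then show ?thesis
    by (rule field_le_epsilon)
qed

lemma represents_lin:
  assumes repf: "represents f c" and reph: "represents h c'" and f: "f \<in> l2v S R" and h: "h \<in> l2v S R"
  shows "represents (\<lambda>r j. a * f r j + h r j) (\<lambda>i. a * c i + c' i)"
  unfolding represents_def
proof (intro allI impI)
  fix \<epsilon> :: real assume "\<epsilon> > 0"
  define \<eta> where "\<eta> = \<epsilon> / (cmod a + 1)"
  have pos: "cmod a + 1 > 0"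
    by (simp add: add_nonneg_pos)
  then have "\<eta> > 0" and "(cmod a + 1) * \<eta> = \<epsilon>"
    using \<open>\<epsilon> > 0\<close> by (simp_all add: \<eta>_def)
  then have \<eta>: "cmod a * \<eta> + \<eta> = \<epsilon>"
    by (simp add: distrib_right)
  from repf \<open>\<eta> > 0\<close> obtain F b where b: "fincoeff F b" and
    n: "l2v_norm R (\<lambda>r j. f r j - lincomb b e F r j) \<le> \<eta>" and
    l: "\<And>G. finite G \<Longrightarrow> L2_set (\<lambda>i. cmod (c i - b i)) G \<le> \<eta>"
    unfolding represents_def by blast
  from reph \<open>\<eta> > 0\<close> obtain F' b' where b': "fincoeff F' b'" and
    n': "l2v_norm R (\<lambda>r j. h r j - lincomb b' e F' r j) \<le> \<eta>" and
    l': "\<And>G. finite G \<Longrightarrow> L2_set (\<lambda>i. cmod (c' i - b' i)) G \<le> \<eta>"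
    unfolding represents_def by blast
  have F: "lincomb b e F \<in> l2v S R" "lincomb b' e F' \<in> l2v S R"
    using b b' by (auto simp: fincoeff_def intro: lincomb_in_l2v)
  have "fincoeff (F \<union> F') (\<lambda>i. a * b i + b' i)"
    using b b' by (simp add: fincoeff_def)
  moreover have "l2v_norm R (\<lambda>r j. (a * f r j + h r j) - lincomb (\<lambda>i. a * b i + b' i) e (F \<union> F') r j) \<le> \<epsilon>"
  proof -
    have "lincomb (\<lambda>i. a * b i + b' i) e (F \<union> F') = (\<lambda>r j. a * lincomb b e F r j + lincomb b' e F' r j)"
      using b b' by (intro lincomb_lin) (auto simp: fincoeff_def)
    then have "(\<lambda>r j. (a * f r j + h r j) - lincomb (\<lambda>i. a * b i + b' i) e (F \<union> F') r j) =
        (\<lambda>r j. a * (f r j - lincomb b e F r j) + (h r j - lincomb b' e F' r j))"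
      by (simp add: algebra_simps)
    then have "l2v_norm R (\<lambda>r j. (a * f r j + h r j) - lincomb (\<lambda>i. a * b i + b' i) e (F \<union> F') r j)
        \<le> cmod a * l2v_norm R (\<lambda>r j. f r j - lincomb b e F r j) + l2v_norm R (\<lambda>r j. h r j - lincomb b' e F' r j)"
      using l2v_norm_lin[OF l2v_diff[OF f F(1)] l2v_diff[OF h F(2)], of a] by simp
    also have "\<dots> \<le> cmod a * \<eta> + \<eta>"
      using n n' by (intro add_mono mult_left_mono) auto
    finally show ?thesis
      by (simp add: \<eta>)
  qed
  moreover have "L2_set (\<lambda>i. cmod ((a * c i + c' i) - (a * b i + b' i))) G \<le> \<epsilon>" if G: "finite G" for G
  proof -
    have "L2_set (\<lambda>i. cmod ((a * c i + c' i) - (a * b i + b' i))) G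
        \<le> L2_set (\<lambda>i. cmod a * cmod (c i - b i) + cmod (c' i - b' i)) G"
    proof (rule L2_set_mono)
      fix i
      have "(a * c i + c' i) - (a * b i + b' i) = a * (c i - b i) + (c' i - b' i)"
        by (simp add: algebra_simps)
      then show "cmod ((a * c i + c' i) - (a * b i + b' i)) \<le> cmod a * cmod (c i - b i) + cmod (c' i - b' i)"
        by (metis norm_mult norm_triangle_ineq)
    qed simp
    also have "\<dots> \<le> L2_set (\<lambda>i. cmod a * cmod (c i - b i)) G + L2_set (\<lambda>i. cmod (c' i - b' i)) G"
      by (rule L2_set_triangle_ineq)
    also have "L2_set (\<lambda>i. cmod a * cmod (c i - b i)) G = cmod a * L2_set (\<lambda>i. cmod (c i - b i)) G"
      by (simp add: L2_set_right_distrib)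
    also have "cmod a * L2_set (\<lambda>i. cmod (c i - b i)) G + L2_set (\<lambda>i. cmod (c' i - b' i)) G \<le> cmod a * \<eta> + \<eta>"
      using l[OF G] l'[OF G] by (intro add_mono mult_left_mono) auto
    finally show ?thesis
      by (simp add: \<eta>)
  qed
  ultimately show "\<exists>F b. fincoeff F b \<and>
      l2v_norm R (\<lambda>r j. (a * f r j + h r j) - lincomb b e F r j) \<le> \<epsilon> \<and>
      (\<forall>G. finite G \<longrightarrow> L2_set (\<lambda>i. cmod ((a * c i + c' i) - b i)) G \<le> \<epsilon>)"
    by blast
qed

text \<open>The difference of the two families represents - f + f = 0, and
  \<open>represents_bound\<close> then forces it to vanish.\<close>

lemma represents_unique:
  assumes "represents f c" "represents f c'" "f \<in> l2v S R"
  shows "c = c'"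
proof
  fix i
  have "cmod (- 1 * c i + c' i) \<le> l2v_norm R (\<lambda>r j. - 1 * f r j + f r j) / sqrt A"
    using represents_bound[OF represents_lin[OF assms(1,2,3,3), of "- 1"] l2v_lin[OF assms(3,3), of "- 1"]] .
  then show "c i = c' i"
    by simp
qed

lemma represents_basis: "k \<in> I \<Longrightarrow> represents (e k) (\<lambda>i. if i = k then 1 else 0)"
  unfolding represents_def
  by (intro allI impI exI[of _ "{k}"] exI[of _ "\<lambda>i. if i = k then 1 else 0"])
    (auto simp: fincoeff_def lincomb_def L2_set_def)

text \<open>Completeness supplies finite expansions converging to \<open>f\<close>. By the lower
  Riesz inequality their coefficients are Cauchy in the square norm, uniformly over finite
  \<open>G\<close>; the limit is taken coordinate by coordinate.\<close>

lemma represents_exists: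
  assumes f: "f \<in> l2v S R"
  obtains c where "represents f c"
proof -
  have "\<exists>F b. fincoeff F b \<and> l2v_norm R (\<lambda>r j. f r j - lincomb b e F r j) \<le> inverse (real (Suc n))" for n
  proof -
    have "inverse (real (Suc n)) > 0"
      by simp
    from complete_familyE[OF complete f this] obtain F c where F: "finite F" "F \<subseteq> I"
      "l2v_norm R (\<lambda>r j. f r j - lincomb c e F r j) < inverse (real (Suc n))"
      by blast
    have "lincomb (\<lambda>i. if i \<in> F then c i else 0) e F = lincomb c e F"
      by (simp add: lincomb_def)
    with F show ?thesis
      by (intro exI[of _ F] exI[of _ "\<lambda>i. if i \<in> F then c i else 0"]) (auto simp: fincoeff_def)
  qed
  then obtain F b where b: "\<And>n. fincoeff (F n) (b n)"
    and n: "\<And>n. l2v_norm R (\<lambda>r j. f r j - lincomb (b n) e (F n) r j) \<le> inverse (real (Suc n))"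
    by metis
  let ?\<eta> = "\<lambda>n. inverse (real (Suc n))"
  have F: "lincomb (b n) e (F n) \<in> l2v S R" for n
    using b[of n] by (auto simp: fincoeff_def intro: lincomb_in_l2v)
  have close: "L2_set (\<lambda>i. cmod (b n i - b m i)) G \<le> (?\<eta> n + ?\<eta> m) / sqrt A" if G: "finite G" for n m G
  proof -
    have fc: "fincoeff (F m \<union> F n) (\<lambda>i. - 1 * b m i + b n i)"
      using b[of n] b[of m] by (auto simp: fincoeff_def)
    \<comment> \<open>Both expansions approximate \<open>f\<close>, so their difference is a
      difference of two small remainders.\<close>
    have "lincomb (\<lambda>i. - 1 * b m i + b n i) e (F m \<union> F n) =
        (\<lambda>r j. (f r j - lincomb (b m) e (F m) r j) - (f r j - lincomb (b n) e (F n) r j))"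
      using b[of n] b[of m] by (subst lincomb_lin) (auto simp: fincoeff_def)
    then have "l2v_norm R (lincomb (\<lambda>i. - 1 * b m i + b n i) e (F m \<union> F n)) \<le> ?\<eta> m + ?\<eta> n"
      using l2v_norm_diff[OF l2v_diff[OF f F[of m]] l2v_diff[OF f F[of n]]] n[of m] n[of n] by simp
    then have "l2v_norm R (lincomb (\<lambda>i. - 1 * b m i + b n i) e (F m \<union> F n)) / sqrt A \<le> (?\<eta> n + ?\<eta> m) / sqrt A"
      using A by (simp add: divide_right_mono)
    then show ?thesis
      using lower_L2_set[OF fc G] by simp
  qed
  have \<eta>0: "?\<eta> \<longlonglongrightarrow> 0"
    by (rule LIMSEQ_inverse_real_of_nat)
  have "Cauchy (\<lambda>n. b n i)" for i
  proof (rule metric_CauchyI)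
    fix \<epsilon> :: real assume "\<epsilon> > 0"
    then have "\<epsilon> * sqrt A / 2 > 0"
      using A by simp
    then obtain N where N: "\<And>n. n \<ge> N \<Longrightarrow> ?\<eta> n < \<epsilon> * sqrt A / 2"
      using order_tendstoD(2)[OF \<eta>0] unfolding eventually_sequentially by blast
    have "dist (b m i) (b n i) < \<epsilon>" if "m \<ge> N" "n \<ge> N" for m n
    proof -
      have "dist (b m i) (b n i) \<le> (?\<eta> m + ?\<eta> n) / sqrt A"
        using close[of "{i}" m n] by (simp add: dist_norm)
      also have "\<dots> < \<epsilon>"
        using N[OF that(1)] N[OF that(2)] A by (simp add: divide_less_eq)
      finally show ?thesis .
    qed
    then show "\<exists>N. \<forall>m\<ge>N. \<forall>n\<ge>N. dist (b m i) (b n i) < \<epsilon>"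
      by blast
  qed
  define c where "c i = lim (\<lambda>n. b n i)" for i
  have c: "(\<lambda>n. b n i) \<longlonglongrightarrow> c i" for i
    using \<open>Cauchy (\<lambda>n. b n i)\<close> by (simp add: c_def Cauchy_convergent_iff convergent_LIMSEQ_iff)
  \<comment> \<open>Fix \<open>m\<close> and let \<open>n\<close> tend to infinity in
    \<open>close\<close>; a finite \<open>G\<close> makes \<open>L2_set\<close> continuous in the
    coordinates.\<close>
  have lim: "L2_set (\<lambda>i. cmod (c i - b m i)) G \<le> ?\<eta> m / sqrt A" if G: "finite G" for m G
  proof (rule LIMSEQ_le)
    show "(\<lambda>n. L2_set (\<lambda>i. cmod (b n i - b m i)) G) \<longlonglongrightarrow> L2_set (\<lambda>i. cmod (c i - b m i)) G"
      unfolding L2_set_def by (intro tendsto_intros c)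
    have "(\<lambda>n. (?\<eta> n + ?\<eta> m) / sqrt A) \<longlonglongrightarrow> (0 + ?\<eta> m) / sqrt A"
      using A by (intro tendsto_intros \<eta>0) auto
    then show "(\<lambda>n. (?\<eta> n + ?\<eta> m) / sqrt A) \<longlonglongrightarrow> ?\<eta> m / sqrt A"
      by simp
  qed (use close[OF G, of _ m] in \<open>intro exI[of _ 0] allI impI\<close>)
  have "represents f c"
    unfolding represents_def
  proof (intro allI impI)
    fix \<epsilon> :: real assume "\<epsilon> > 0"
    then have "min \<epsilon> (\<epsilon> * sqrt A) > 0"
      using A by simp
    \<comment> \<open>The first entry of the minimum controls the norm of the remainder, the second
      the error of the coefficients.\<close>
    then obtain m where m: "?\<eta> m < min \<epsilon> (\<epsilon> * sqrt A)"
      using reals_Archimedean by blast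
    then have "?\<eta> m / sqrt A \<le> \<epsilon>"
      using A by (simp add: divide_le_eq)
    with m lim n[of m] b[of m] show "\<exists>F b. fincoeff F b \<and>
        l2v_norm R (\<lambda>r j. f r j - lincomb b e F r j) \<le> \<epsilon> \<and>
        (\<forall>G. finite G \<longrightarrow> L2_set (\<lambda>i. cmod (c i - b i)) G \<le> \<epsilon>)"
      by (intro exI[of _ "F m"] exI[of _ "b m"]) (auto intro: order_trans)
  qed
  then show thesis
    by (rule that)
qed

text \<open>Here the upper Riesz inequality enters: it bounds the vector with coefficients
  \<open>c i - b i\<close> on any finite \<open>G\<close> containing \<open>F\<close>, so the
  partial sums over all such \<open>G\<close> are close to \<open>f\<close>.\<close>

lemma represents_has_sum:
  assumes rep: "represents f c" and f: "f \<in> l2v S R" and r: "r \<in> {1..R}"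
  shows "((\<lambda>i. c i * e i r j) has_sum f r j) I"
  unfolding has_sum_def tendsto_iff eventually_finite_subsets_at_top
proof (intro allI impI)
  fix \<epsilon> :: real assume "\<epsilon> > 0"
  \<comment> \<open>The error is at most (1 + \<open>sqrt B\<close>) times \<open>\<eta>\<close>;
    writing 2 for 1 makes the final inequality strict.\<close>
  define \<eta> where "\<eta> = \<epsilon> / (2 + sqrt B)"
  have "2 + sqrt B > 0"
    using B by (simp add: add_pos_nonneg)
  then have "\<eta> > 0" and \<eta>: "(2 + sqrt B) * \<eta> = \<epsilon>"
    using \<open>\<epsilon> > 0\<close> by (simp_all add: \<eta>_def)
  from rep \<open>\<eta> > 0\<close> obtain F b where b: "fincoeff F b" and
    n: "l2v_norm R (\<lambda>r j. f r j - lincomb b e F r j) \<le> \<eta>" and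
    l: "\<And>G. finite G \<Longrightarrow> L2_set (\<lambda>i. cmod (c i - b i)) G \<le> \<eta>"
    unfolding represents_def by blast
  have F: "finite F" "F \<subseteq> I" and z: "\<And>i. i \<notin> F \<Longrightarrow> b i = 0"
    using b by (auto simp: fincoeff_def)
  have "dist (\<Sum>i\<in>G. c i * e i r j) (f r j) < \<epsilon>" if G: "finite G" "F \<subseteq> G" "G \<subseteq> I" for G
  proof -
    have "f r j - (\<Sum>i\<in>G. c i * e i r j) = (f r j - lincomb b e F r j) - lincomb (\<lambda>i. c i - b i) e G r j"
    proof -
      have "lincomb b e F = lincomb b e G"
        by (rule lincomb_extend[symmetric]) (use G z in auto)
      then show ?thesis
        by (simp add: lincomb_def left_diff_distrib sum_subtractf)
    qed
    then have "dist (\<Sum>i\<in>G. c i * e i r j) (f r j) \<le>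
        cmod (f r j - lincomb b e F r j) + cmod (lincomb (\<lambda>i. c i - b i) e G r j)"
      unfolding dist_norm norm_minus_commute[of _ "f r j"] by (simp only: norm_triangle_ineq4)
    also have "cmod (f r j - lincomb b e F r j) \<le> \<eta>"
      using norm_le_l2v_norm[OF l2v_diff[OF f lincomb_in_l2v[OF F]] r] n by (rule order_trans)
    also have "cmod (lincomb (\<lambda>i. c i - b i) e G r j) \<le> l2v_norm R (lincomb (\<lambda>i. c i - b i) e G)"
      by (rule norm_le_l2v_norm[OF lincomb_in_l2v[OF G(1,3)] r])
    also have "\<dots> \<le> sqrt B * L2_set (\<lambda>i. cmod (c i - b i)) G"
      by (rule upper_L2_set[OF G(1,3)])
    also have "\<dots> \<le> sqrt B * \<eta>"
      using l[OF G(1)] B by (intro mult_left_mono) auto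
    also have "\<eta> + sqrt B * \<eta> < \<epsilon>"
      using \<eta> \<open>\<eta> > 0\<close> by (simp add: distrib_right)
    finally show ?thesis
      by simp
  qed
  with F show "\<exists>X. finite X \<and> X \<subseteq> I \<and> (\<forall>Y. finite Y \<and> X \<subseteq> Y \<and> Y \<subseteq> I \<longrightarrow>
      dist (\<Sum>i\<in>Y. c i * e i r j) (f r j) < \<epsilon>)"
    by blast
qed

end

text \<open>Together with completeness, this is what the trace argument uses of a Riesz basis. The
  index \<open>i\<close> is unrestricted: outside \<open>I\<close> the coefficients on
  \<open>l2v S R\<close> are 0.\<close>

lemma riesz_basis_coefficients:
  assumes "riesz_basis S R I e"
  obtains \<phi> where "\<And>i. bounded_functional S R (\<phi> i)"
    and "\<And>i k. k \<in> I \<Longrightarrow> \<phi> i (e k) = (if i = k then 1 else 0)"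
    and "\<And>f r j. f \<in> l2v S R \<Longrightarrow> r \<in> {1..R} \<Longrightarrow> ((\<lambda>i. \<phi> i f * e i r j) has_sum f r j) I"
proof -
  obtain A B where "A > 0" "B > 0" and AB: "\<forall>F c. finite F \<and> F \<subseteq> I \<longrightarrow>
      A * (\<Sum>i\<in>F. (cmod (c i))\<^sup>2) \<le> (l2v_norm R (lincomb c e F))\<^sup>2 \<and>
      (l2v_norm R (lincomb c e F))\<^sup>2 \<le> B * (\<Sum>i\<in>F. (cmod (c i))\<^sup>2)"
    using assms unfolding riesz_basis_def riesz_sequence_def by (elim conjE exE) (rule that)
  interpret riesz_family S R I e A B
    using assms \<open>A > 0\<close> \<open>B > 0\<close> AB
    by unfold_locales (simp_all add: riesz_basis_def riesz_sequence_def)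
  define c where "c f = (SOME c. represents f c)" for f
  have c: "represents f (c f)" if "f \<in> l2v S R" for f
  proof -
    obtain c' where "represents f c'"
      using represents_exists \<open>f \<in> l2v S R\<close> by blast
    then show ?thesis
      unfolding c_def by (rule someI[of "represents f"])
  qed
  show thesis
  proof (rule that[of "\<lambda>i f. c f i"])
    fix i
    have "c (\<lambda>r j. a * f r j + h r j) = (\<lambda>i. a * c f i + c h i)" if "f \<in> l2v S R" "h \<in> l2v S R" for a f h
      by (rule represents_unique[OF c[OF l2v_lin[OF that]] represents_lin[OF c[OF that(1)] c[OF that(2)] that] l2v_lin[OF that]])
    moreover have "cmod (c f i) \<le> (1 / sqrt A) * l2v_norm R f" if "f \<in> l2v S R" for f
      using represents_bound[OF c[OF that] that] by simp
    ultimately show "bounded_functional S R (\<lambda>f. c f i)"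
      unfolding bounded_functional_def using A
      by (intro conjI ballI allI exI[of _ "1 / sqrt A"]) simp_all
  next
    fix i k assume "k \<in> I"
    then show "c (e k) i = (if i = k then 1 else 0)"
      by (simp add: represents_unique[OF c[OF e[OF \<open>k \<in> I\<close>]] represents_basis[OF \<open>k \<in> I\<close>] e[OF \<open>k \<in> I\<close>]])
  next
    fix f r j assume "f \<in> l2v S R" "r \<in> {1..R}"
    then show "((\<lambda>i. c f i * e i r j) has_sum f r j) I"
      by (intro represents_has_sum c)
  qed
qed


section \<open>Characters and time-frequency shifts\<close>

text \<open>All phases are values of this one character of Z / M at integers, so that identities
  between phases become identities or congruences between integers.\<close>

definition chi :: "nat \<Rightarrow> int \<Rightarrow> complex" where
  "chi M x = cis (2 * pi * of_int x / of_nat M)"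

lemma chi_add: "chi M (x + y) = chi M x * chi M y"
  by (simp add: chi_def cis_mult add_divide_distrib distrib_left)

lemma chi_0 [simp]: "chi M 0 = 1"
  by (simp add: chi_def)

lemma norm_chi [simp]: "cmod (chi M x) = 1"
  by (simp add: chi_def)

lemma chi_neq_0 [simp]: "chi M x \<noteq> 0"
  by (simp add: chi_def)

lemma cnj_chi: "cnj (chi M x) = chi M (- x)"
  by (simp add: chi_def cis_cnj)

lemma chi_mult_power: "chi M (int t * x) = chi M x ^ t"
  by (induction t) (simp_all add: distrib_right chi_add)

lemma chi_eq_1_iff:
  assumes "M > 0"
  shows "chi M x = 1 \<longleftrightarrow> int M dvd x"
proof -
  have "chi M x = 1 \<longleftrightarrow> (\<exists>n::int. 2 * pi * of_int x / of_nat M = of_int n * (2 * pi))"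
    using cos_one_2pi_int[of "2 * pi * of_int x / of_nat M"]
    by (auto simp: chi_def complex_eq_iff mult.assoc intro: cos_one_sin_zero)
  also have "\<dots> \<longleftrightarrow> (\<exists>n::int. real_of_int x = of_int (int M * n))"
    using assms by (simp add: field_simps)
  also have "\<dots> \<longleftrightarrow> int M dvd x"
    unfolding of_int_eq_iff dvd_def ..
  finally show ?thesis .
qed

lemma chi_cong:
  assumes "M > 0" "int M dvd x - y"
  shows "chi M x = chi M y"
  using chi_add[of M "x - y" y] chi_eq_1_iff[of M "x - y"] assms by simp

text \<open>A geometric sum whose ratio is an \<open>M\<close>-th root of unity: orthogonality of
  the characters of Z / M.\<close>

lemma sum_chi:
  assumes "M > 0"
  shows "(\<Sum>t<M. chi M (int t * x)) = (if int M dvd x then of_nat M else 0)"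
proof (cases "int M dvd x")
  case True
  then have "chi M x = 1"
    using assms by (simp add: chi_eq_1_iff)
  then show ?thesis
    using True by (simp add: chi_mult_power)
next
  case False
  then have "chi M x \<noteq> 1"
    using assms by (simp add: chi_eq_1_iff)
  moreover have "chi M x ^ M = 1"
    using assms by (simp add: chi_eq_1_iff flip: chi_mult_power)
  ultimately show ?thesis
    using False by (simp add: chi_mult_power geometric_sum)
qed

lemma gabor_apply: "gabor g M N (m, n, l) r j = chi M (int m * j) * g l r (j - n * int N)"
proof -
  have "exp (2 * of_real pi * \<i> * of_real (real m / real M) * of_int j) = chi M (int m * j)"
    by (simp add: chi_def cis_conv_exp mult_ac)
  then show ?thesis
    by (simp add: gabor_def modulation_def translation_def)
qed

section \<open>Time-frequency shifts on a periodic set, and orbits inside a residue class\<close>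

lemma periodic_set_iff:
  assumes "periodic_set N S"
  shows "j + n * int N \<in> S \<longleftrightarrow> j \<in> S" "j - n * int N \<in> S \<longleftrightarrow> j \<in> S"
proof -
  have *: "j + n * int N \<in> S" if "j \<in> S" for j n
    using assms that by (simp add: periodic_set_def)
  show "j + n * int N \<in> S \<longleftrightarrow> j \<in> S"
    using *[of j n] *[of "j + n * int N" "- n"] by auto
  show "j - n * int N \<in> S \<longleftrightarrow> j \<in> S"
    using *[of j "- n"] *[of "j - n * int N" n] by auto
qed

lemma
  assumes S: "periodic_set N S" and f: "f \<in> l2v S R"
  shows l2v_time_frequency_shift: "(\<lambda>r j. chi M (k * j) * f r (j - n * int N)) \<in> l2v S R" (is "?f \<in> _")
    and l2v_norm_time_frequency_shift: "l2v_norm R (\<lambda>r j. chi M (k * j) * f r (j - n * int N)) \<le> l2v_norm R f"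
proof -
  have fin: "(\<Sum>j\<in>J. \<Sum>r=1..R. (cmod (?f r j))\<^sup>2) \<le> (l2v_norm R f)\<^sup>2" if J: "finite J" for J
  proof -
    have "(\<Sum>j\<in>J. \<Sum>r=1..R. (cmod (?f r j))\<^sup>2) = (\<Sum>j\<in>(\<lambda>j. j - n * int N) ` J. \<Sum>r=1..R. (cmod (f r j))\<^sup>2)"
      by (subst sum.reindex) (auto simp: inj_on_def norm_mult)
    also have "\<dots> \<le> (l2v_norm R f)\<^sup>2"
      using J by (intro sum_le_l2v_norm[OF f]) simp
    finally show ?thesis .
  qed
  have z: "?f r j = 0" if "r \<notin> {1..R} \<or> j \<notin> S" for r j
    using l2v_zero[OF f, of r "j - n * int N"] that by (simp add: periodic_set_iff(2)[OF S])
  show "?f \<in> l2v S R"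
    by (rule sum_bounded_in_l2v(1)[where f = ?f, OF fin z l2v_norm_nonneg])
  show "l2v_norm R ?f \<le> l2v_norm R f"
    by (rule sum_bounded_in_l2v(2)[where f = ?f, OF fin z l2v_norm_nonneg])
qed

lemma gabor_in_l2v:
  assumes "periodic_set N S" "g l \<in> l2v S R"
  shows "gabor g M N (m, n, l) \<in> l2v S R"
proof -
  have "gabor g M N (m, n, l) = (\<lambda>r j. chi M (int m * j) * g l r (j - n * int N))"
    by (intro ext gabor_apply)
  then show ?thesis
    using l2v_time_frequency_shift[OF assms] by simp
qed

text \<open>Dividing by d reduces the claim to (j - a) / d = k q - n p. As q is invertible modulo p,
  a suitable k < p exists and n is the remaining quotient. With M = q d and N = p d, the class of a
  modulo d is covered by p orbits of N Z.\<close>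

lemma residue_decomposition_exists:
  fixes a j :: int and p q d :: nat
  assumes "p > 0" "coprime p q" "int d dvd j - a"
  obtains k n where "k < p" "j = a + int k * int (q * d) - n * int (p * d)"
proof -
  obtain t where t: "j - a = int d * t"
    using assms(3) by (elim dvdE)
  obtain u v where uv: "u * int q + v * int p = 1"
    using bezout_int[of "int q" "int p"] assms(2) by (auto simp: coprime_commute coprime_iff_gcd_eq_1)
  \<comment> \<open>By Bezout, \<open>u\<close> inverts q modulo p, so \<open>t * u\<close> solves k
    q = t modulo p.\<close>
  define k where "k = (t * u) mod int p"
  have "k = t * u - int p * ((t * u) div int p)"
    by (simp add: k_def minus_mult_div_eq_mod)
  then have "k * int q = t * u * int q - int p * ((t * u) div int p) * int q"
    by (simp add: left_diff_distrib)
  also have "t * u * int q = t - t * v * int p"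
    using arg_cong[OF uv, of "\<lambda>x. t * x"] by (simp add: algebra_simps)
  finally have kq: "k * int q = t - int p * (t * v + ((t * u) div int p) * int q)"
    by (simp add: algebra_simps)
  have k: "0 \<le> k" "k < int p"
    using assms(1) by (simp_all add: k_def)
  define n where "n = - (t * v + ((t * u) div int p) * int q)"
  have "j = a + k * int q * int d - n * (int p * int d)"
    unfolding kq n_def using t by (simp add: algebra_simps)
  then show thesis
    using k by (intro that[of "nat k" n]) (auto simp: mult.assoc nat_less_iff)
qed

text \<open>Cancelling d leaves (k - k') q = (n - n') p, so p divides k - k' by coprimality, while
  both numbers are below p. Hence the p orbits are disjoint and each is parametrised injectively by
  n.\<close>

lemma residue_decomposition_unique:
  fixes n n' :: int and p q d k k' :: nat
  assumes "p > 0" "d > 0" "coprime p q" "k < p" "k' < p"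
    and eq: "int k * int (q * d) - n * int (p * d) = int k' * int (q * d) - n' * int (p * d)"
  shows "k = k' \<and> n = n'"
proof -
  have "int d * ((int k - int k') * int q) = int d * ((n - n') * int p)"
    using eq by (simp add: algebra_simps)
  then have *: "(int k - int k') * int q = (n - n') * int p"
    using assms(2) by simp
  then have "int p dvd (int k - int k') * int q"
    by simp
  then have "int p dvd int k - int k'"
    using assms(3) by (simp add: coprime_dvd_mult_left_iff)
  then have "int k mod int p = int k' mod int p"
    by (simp add: mod_eq_dvd_iff)
  then have "k = k'"
    using assms(4,5) by simp
  with * assms(1) show ?thesis
    by simp
qed


section \<open>The trace formula for a Gabor Riesz basis\<close>

lemma bounded_functional_time_frequency_shift:
  assumes S: "periodic_set N S" and \<phi>: "bounded_functional S R \<phi>"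
  shows "bounded_functional S R (\<lambda>f. \<phi> (\<lambda>r j. chi M (k * j) * f r (j - n * int N)))"
proof -
  let ?W = "\<lambda>f r j. chi M (k * j) * f r (j - n * int N)"
  note W = l2v_time_frequency_shift[OF S, of _ R M k n]
  obtain C where C: "C \<ge> 0" "\<And>f. f \<in> l2v S R \<Longrightarrow> cmod (\<phi> f) \<le> C * l2v_norm R f"
    using \<phi> unfolding bounded_functional_def by blast
  have lin: "\<phi> (\<lambda>r j. a * f r j + h r j) = a * \<phi> f + \<phi> h" if "f \<in> l2v S R" "h \<in> l2v S R" for a f h
    using \<phi> that unfolding bounded_functional_def by blast
  have "\<phi> (?W (\<lambda>r j. a * f r j + h r j)) = a * \<phi> (?W f) + \<phi> (?W h)"
    if "f \<in> l2v S R" "h \<in> l2v S R" for a f h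
    using lin[OF W[OF that(1)] W[OF that(2)], of a] by (simp add: algebra_simps)
  moreover have "cmod (\<phi> (?W f)) \<le> C * l2v_norm R f" if f: "f \<in> l2v S R" for f
    using C(2)[OF W[OF f]] mult_left_mono[OF l2v_norm_time_frequency_shift[OF S f, of M k n] C(1)]
    by linarith
  ultimately show ?thesis
    using C(1) unfolding bounded_functional_def by blast
qed

lemma riesz_basis_imp_card:
  fixes L M N R p q d :: nat and S :: "int set"
  assumes pos: "M > 0" "N > 0" "p > 0" "q > 0" and pq: "coprime p q"
    and M: "M = q * d" and N: "N = p * d"
    and S: "periodic_set N S" and g: "\<And>l. l < L \<Longrightarrow> g l \<in> l2v S R"
    and rb: "riesz_basis S R (gabor_index L M) (gabor g M N)"
  shows "R * card (K_set S M p a) = q * L"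
proof -
  let ?I = "gabor_index L M" and ?e = "gabor g M N"
  have d: "d > 0"
    using pos(1) M by simp
  have e: "?e i \<in> l2v S R" if "i \<in> ?I" for i
    using that gabor_in_l2v[OF S g] by (auto simp: gabor_index_def)
  obtain \<phi> where bf: "\<And>i. bounded_functional S R (\<phi> i)"
    and bio: "\<And>i k. k \<in> ?I \<Longrightarrow> \<phi> i (?e k) = (if i = k then 1 else 0)"
    and rec: "\<And>f r j. f \<in> l2v S R \<Longrightarrow> r \<in> {1..R} \<Longrightarrow> ((\<lambda>i. \<phi> i f * ?e i r j) has_sum f r j) ?I"
    by (rule riesz_basis_coefficients[OF rb]) blast
  have cpl: "complete_family S R ?I ?e"
    using rb by (simp add: riesz_basis_def)

  \<comment> \<open>Covariance of the dual system. Both sides are bounded functionals of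
    \<open>f\<close>, so it is enough to test them on the basis; a shift sends a basis element to a
    phase times another one, with the modulation index taken modulo \<open>M\<close>.\<close>
  have shift: "\<phi> (m, n, l) (\<lambda>r j. chi M (int m * j) * f r (j - n * int N)) = \<phi> (0, 0, l) f"
    if m: "m < M" and f: "f \<in> l2v S R" for m n l f
  proof (rule bounded_functional_unique[OF bounded_functional_time_frequency_shift[OF S bf] bf e cpl _ f])
    fix i assume i: "i \<in> ?I"
    obtain m' n' l' where i_eq: "i = (m', n', l')" and m': "m' < M" and l': "l' < L"
      using i by (auto simp: gabor_index_def)
    let ?k = "((m + m') mod M, n + n', l')"
    have k: "?k \<in> ?I"
      using pos(1) l' by (simp add: gabor_index_def)
    have "chi M (int m * j) * ?e i r (j - n * int N) = chi M (- (int m' * n * int N)) * ?e ?k r j" for r j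
    proof -
      have "chi M (int ((m + m') mod M) * j) = chi M ((int m + int m') * j)"
      proof (rule chi_cong[OF pos(1)])
        have "int ((m + m') mod M) * j - (int m + int m') * j = (int (m + m') mod int M - int (m + m')) * j"
          by (simp add: left_diff_distrib zmod_int)
        moreover have "int M dvd int (m + m') mod int M - int (m + m')"
          by (rule mod_eq_dvd_iff[THEN iffD1]) simp
        ultimately show "int M dvd int ((m + m') mod M) * j - (int m + int m') * j"
          by simp
      qed
      moreover have "chi M (int m * j) * chi M (int m' * (j - n * int N)) =
          chi M (- (int m' * n * int N)) * chi M ((int m + int m') * j)"
        unfolding chi_add[symmetric] by (rule arg_cong[of _ _ "chi M"]) (simp add: algebra_simps)
      moreover have "g l' r (j - n * int N - n' * int N) = g l' r (j - (n + n') * int N)"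
        by (simp add: algebra_simps)
      ultimately show ?thesis
        unfolding i_eq gabor_apply by (simp add: mult.assoc[symmetric])
    qed
    then have "\<phi> (m, n, l) (\<lambda>r j. chi M (int m * j) * ?e i r (j - n * int N)) =
        chi M (- (int m' * n * int N)) * \<phi> (m, n, l) (?e ?k)"
      using bounded_functional_scale[OF bf e[OF k]] by simp
    \<comment> \<open>The value is nonzero only for \<open>m' = 0\<close>, \<open>n' = 0\<close> and
      \<open>l' = l\<close>, and there the phase is 1.\<close>
    also have "\<dots> = (if (0, 0, l) = i then 1 else 0)"
    proof -
      have "(m + m') mod M = m \<longleftrightarrow> m' = 0"
        using m m' by (cases "m + m' < M") (auto simp: mod_if)
      then show ?thesis
        unfolding bio[OF k] i_eq by auto
    qed
    finally show "\<phi> (m, n, l) (\<lambda>r j. chi M (int m * j) * ?e i r (j - n * int N)) = \<phi> (0, 0, l) (?e i)"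
      unfolding bio[OF i] .
  qed

  \<comment> \<open>The pointwise product of a generator with the conjugate of its dual generator.
    Its sum \<open>V\<close> over \<open>l\<close> and \<open>r\<close> is the density w(j) of the
    overview.\<close>
  define w where "w l r j = g l r j * \<phi> (0, 0, l) (unit_vseq S (j, r))" for l r j
  define V where "V j = (\<Sum>l<L. \<Sum>r=1..R. w l r j)" for j

  have V_orbit: "((\<lambda>n. of_nat M * V (j - n * int N)) has_sum of_nat R * of_bool (j \<in> S)) UNIV" for j
  proof -
    have "((\<lambda>n. \<Sum>(m, l)\<in>{..<M} \<times> {..<L}. w l r (j - n * int N)) has_sum of_bool (j \<in> S)) UNIV"
      if r: "r \<in> {1..R}" for r
    proof -
      \<comment> \<open>The phase in the coefficient cancels the modulation of the basis element at
        \<open>j\<close>. The summand is thus independent of \<open>m\<close>, which is the origin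
        of the factor \<open>M\<close>.\<close>
      have term_eq: "\<phi> (m, n, l) (unit_vseq S (j, r)) * ?e (m, n, l) r j = w l r (j - n * int N)"
        if "m < M" for m n l
      proof -
        have "(\<lambda>r' j'. chi M (int m * j') * unit_vseq S (j - n * int N, r) r' (j' - n * int N)) =
            (\<lambda>r' j'. chi M (int m * j) * unit_vseq S (j, r) r' j')"
          by (intro ext) (simp add: unit_vseq_def periodic_set_iff(2)[OF S])
        then have "\<phi> (0, 0, l) (unit_vseq S (j - n * int N, r)) = chi M (int m * j) * \<phi> (m, n, l) (unit_vseq S (j, r))"
          using shift[OF that unit_vseq_in_l2v[OF r], of n l "j - n * int N"]
            bounded_functional_scale[OF bf unit_vseq_in_l2v[OF r]] by simp
        then show ?thesis
          by (simp add: w_def gabor_apply)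
      qed
      have "((\<lambda>i. \<phi> i (unit_vseq S (j, r)) * ?e i r j) has_sum of_bool (j \<in> S)) ?I"
      proof -
        have "unit_vseq S (j, r) r j = of_bool (j \<in> S)"
          by (simp add: unit_vseq_def)
        then show ?thesis
          using rec[OF unit_vseq_in_l2v[OF r] r, of j j] by (simp only:)
      qed
      \<comment> \<open>The infinite variable \<open>n\<close> is moved outermost; summing out the
        finitely many (m, l) leaves a sum along the orbit of \<open>j\<close>.\<close>
      then have "((\<lambda>(n, m, l). w l r (j - n * int N)) has_sum of_bool (j \<in> S)) (UNIV \<times> ({..<M} \<times> {..<L}))"
        by (subst has_sum_reindex_bij_witness[where i = "\<lambda>(m, n, l). (n, m, l)" and j = "\<lambda>(n, m, l). (m, n, l)"
              and T = ?I and h = "\<lambda>i. \<phi> i (unit_vseq S (j, r)) * ?e i r j"])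
          (auto simp: gabor_index_def term_eq)
      then show ?thesis
        by (rule has_sum_SigmaD) (auto simp: has_sum_finite_iff case_prod_unfold)
    qed
    then have "((\<lambda>n. \<Sum>r=1..R. \<Sum>(m, l)\<in>{..<M} \<times> {..<L}. w l r (j - n * int N)) has_sum (\<Sum>r=1..R. of_bool (j \<in> S))) UNIV"
      by (rule has_sum_sum)
    moreover have "(\<Sum>r=1..R. \<Sum>(m, l)\<in>{..<M} \<times> {..<L}. w l r i) = of_nat M * V i" for i
    proof -
      have "(\<Sum>(m, l)\<in>{..<M} \<times> {..<L}. w l r i) = of_nat M * (\<Sum>l<L. w l r i)" for r
        by (simp add: sum.cartesian_product[symmetric])
      then show ?thesis
        unfolding V_def by (subst sum.swap) (simp add: sum_distrib_left)
    qed
    ultimately show ?thesis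
      by simp
  qed

  define C where "C = {j. int d dvd j - int a}"
  have V_class: "(V has_sum (of_nat L / of_nat d)) C"
  proof -
    have "((\<lambda>j. \<Sum>r=1..R. w l r j) has_sum (1 / of_nat d)) C" if l: "l < L" for l
    proof -
      let ?f = "\<lambda>r j. if j \<in> C then g l r j else 0"
      have f: "?f \<in> l2v S R"
        by (rule l2v_restrict[OF g[OF l]])
      have mq: "m * q < M" if "m < d" for m
        using that pos(4) by (simp add: M)
      have idx: "(m * q, 0, l) \<in> ?I" if "m < d" for m
        using mq[OF that] l by (simp add: gabor_index_def)
      \<comment> \<open>The indicator of \<open>C\<close> is an average of characters of Z / d.
        Since m / d = m q / M, the restriction of a generator to \<open>C\<close> is a finite
        combination of its modulations within the system.\<close>
      have "?f = lincomb (\<lambda>m. chi d (int m * - int a) / of_nat d) (\<lambda>m. ?e (m * q, 0, l)) {..<d}"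
      proof (intro ext)
        fix r j
        have term_eq: "chi d (int m * - int a) / of_nat d * ?e (m * q, 0, l) r j =
            chi d (int m * (j - int a)) / of_nat d * g l r j" for m
        proof -
          have "chi M (int (m * q) * j) = chi d (int m * j)"
            using pos(4) by (simp add: chi_def M mult.assoc)
          moreover have "chi d (int m * (j - int a)) = chi d (int m * - int a) * chi d (int m * j)"
            unfolding chi_add[symmetric] by (rule arg_cong[of _ _ "chi d"]) (simp add: algebra_simps)
          ultimately show ?thesis
            by (simp add: gabor_apply)
        qed
        have "lincomb (\<lambda>m. chi d (int m * - int a) / of_nat d) (\<lambda>m. ?e (m * q, 0, l)) {..<d} r j =
            (\<Sum>m<d. chi d (int m * (j - int a))) / of_nat d * g l r j"
          unfolding lincomb_def term_eq sum_divide_distrib sum_distrib_right ..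
        also have "\<dots> = ?f r j"
          using d by (simp add: sum_chi C_def)
        finally show "?f r j = lincomb (\<lambda>m. chi d (int m * - int a) / of_nat d) (\<lambda>m. ?e (m * q, 0, l)) {..<d} r j"
          by simp
      qed
      then have "\<phi> (0, 0, l) ?f = (\<Sum>m<d. chi d (int m * - int a) / of_nat d * \<phi> (0, 0, l) (?e (m * q, 0, l)))"
        using bounded_functional_lincomb[OF bf, of "{..<d}"] e[OF idx] by simp
      \<comment> \<open>Only \<open>m = 0\<close> has the index (0, 0, l), as q > 0; its phase is 1,
        which leaves the averaging weight 1 / d.\<close>
      also have "\<dots> = (\<Sum>m<d. if m = 0 then 1 / of_nat d else 0)"
        using pos(4) by (intro sum.cong) (auto simp: bio[OF idx])
      also have "\<dots> = 1 / of_nat d"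
        using d by (simp add: sum.delta)
      finally have "((\<lambda>j. \<Sum>r=1..R. ?f r j * \<phi> (0, 0, l) (unit_vseq S (j, r))) has_sum (1 / of_nat d)) UNIV"
        using bounded_functional_has_sum[OF bf f, of "(0, 0, l)"] by (simp only:)
      then show ?thesis
        by (rule has_sum_cong_neutral[THEN iffD1, rotated -1]) (auto simp: w_def)
    qed
    then have "(V has_sum (\<Sum>l<L. 1 / of_nat d)) C"
      unfolding V_def by (intro has_sum_sum) auto
    then show ?thesis
      by simp
  qed

  \<comment> \<open>The sign of \<open>n\<close> matches the orbit sums in
    \<open>V_orbit\<close>.\<close>
  let ?h = "\<lambda>(k, n). int a + int k * int M - n * int N"
  have "bij_betw ?h ({..<p} \<times> UNIV) C"
  proof (rule bij_betw_imageI)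
    show "inj_on ?h ({..<p} \<times> UNIV)"
    proof (rule inj_onI)
      fix x y assume x: "x \<in> {..<p} \<times> UNIV" and y: "y \<in> {..<p} \<times> UNIV" and eq: "?h x = ?h y"
      have "fst x = fst y \<and> snd x = snd y"
        by (rule residue_decomposition_unique[OF pos(3) d pq])
          (use x y eq in \<open>auto simp: M N case_prod_unfold\<close>)
      then show "x = y"
        by (simp add: prod_eq_iff)
    qed
    have "?h x \<in> C" for x
    proof -
      have "?h x - int a = int d * (int (fst x) * int q - snd x * int p)"
        by (simp add: M N case_prod_unfold algebra_simps)
      then show ?thesis
        unfolding C_def by simp
    qed
    moreover have "j \<in> ?h ` ({..<p} \<times> UNIV)" if "j \<in> C" for j
    proof -
      have "int d dvd j - int a"
        using that by (simp add: C_def)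
      then obtain k n where "k < p" "j = int a + int k * int (q * d) - n * int (p * d)"
        by (rule residue_decomposition_exists[OF pos(3) pq])
      then show ?thesis
        by (intro image_eqI[of _ _ "(k, n)"]) (auto simp: M N)
    qed
    ultimately show "?h ` ({..<p} \<times> UNIV) = C"
      by blast
  qed
  then have "((\<lambda>x. V (?h x)) has_sum (of_nat L / of_nat d)) ({..<p} \<times> UNIV)"
    using V_class by (simp only: has_sum_reindex_bij_betw)
  then have "((\<lambda>x. of_nat M * V (?h x)) has_sum (of_nat M * (of_nat L / of_nat d))) ({..<p} \<times> UNIV)"
    by (rule has_sum_cmult_right)
  \<comment> \<open>Summing out \<open>n\<close> first gives \<open>R\<close> for each orbit inside
    \<open>S\<close> and 0 for the others, so what is left over k < p counts
    \<open>K_set\<close>.\<close>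
  then have "((\<lambda>k. of_nat R * of_bool (int a + int k * int M \<in> S)) has_sum (of_nat M * (of_nat L / of_nat d) :: complex)) {..<p}"
    by (rule has_sum_SigmaD) (simp add: V_orbit)
  then have "of_nat M * (of_nat L / of_nat d) = (\<Sum>k<p. of_nat R * of_bool (int a + int k * int M \<in> S) :: complex)"
    by (simp add: has_sum_finite_iff)
  also have "\<dots> = of_nat R * of_nat (card (K_set S M p a))"
    by (simp add: K_set_def sum_distrib_left[symmetric] of_bool_def sum.If_cases Int_def)
  also have "of_nat M * (of_nat L / of_nat d) = (of_nat (q * L) :: complex)"
    using d by (simp add: M)
  finally show ?thesis
    by (metis of_nat_eq_iff of_nat_mult)
qed


section \<open>Orthonormal bases\<close>

lemma summable_on_inner:
  assumes "f \<in> l2v S R" "h \<in> l2v S R" "r \<in> {1..R}"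
  shows "(\<lambda>j. f r j * cnj (h r j)) summable_on UNIV"
proof -
  have "(\<lambda>j. (cmod (f r j))\<^sup>2 + (cmod (h r j))\<^sup>2) summable_on UNIV"
    using assms by (intro summable_on_add) (auto simp: l2v_def l2_def)
  then have "(\<lambda>j. norm (f r j * cnj (h r j))) summable_on UNIV"
  proof (rule summable_on_comparison_test)
    fix j
    have "2 * (cmod (f r j) * cmod (h r j)) \<le> (cmod (f r j))\<^sup>2 + (cmod (h r j))\<^sup>2"
      using sum_squares_bound[of "cmod (f r j)" "cmod (h r j)"] by (simp add: mult.assoc)
    moreover have "0 \<le> cmod (f r j) * cmod (h r j)"
      by simp
    ultimately show "norm (f r j * cnj (h r j)) \<le> (cmod (f r j))\<^sup>2 + (cmod (h r j))\<^sup>2"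
      unfolding norm_mult complex_mod_cnj by linarith
  qed auto
  then show ?thesis
    by (rule abs_summable_summable)
qed

lemma l2v_inner_lin:
  assumes f: "f \<in> l2v S R" "f' \<in> l2v S R" and h: "h \<in> l2v S R"
  shows "l2v_inner R (\<lambda>r j. a * f r j + f' r j) h = a * l2v_inner R f h + l2v_inner R f' h"
proof -
  have "(\<Sum>\<^sub>\<infinity>j. (a * f r j + f' r j) * cnj (h r j)) =
      a * (\<Sum>\<^sub>\<infinity>j. f r j * cnj (h r j)) + (\<Sum>\<^sub>\<infinity>j. f' r j * cnj (h r j))" if r: "r \<in> {1..R}" for r
    unfolding distrib_right mult.assoc
    by (subst infsum_add)
      (use summable_on_inner[OF f(1) h r] summable_on_inner[OF f(2) h r] in
        \<open>auto intro: summable_on_cmult_right simp: infsum_cmult_right'\<close>)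
  then show ?thesis
    by (simp add: l2v_inner_def sum.distrib sum_distrib_left)
qed

lemma l2v_inner_lincomb_left:
  assumes "finite F" "\<And>i. i \<in> F \<Longrightarrow> e i \<in> l2v S R" and h: "h \<in> l2v S R"
  shows "l2v_inner R (lincomb c e F) h = (\<Sum>i\<in>F. c i * l2v_inner R (e i) h)"
  using assms(1,2)
proof (induction F)
  case empty
  then show ?case
    by (simp add: lincomb_def l2v_inner_def)
next
  case (insert i F)
  have "lincomb c e (insert i F) = (\<lambda>r j. c i * e i r j + lincomb c e F r j)"
    using insert.hyps by (simp add: lincomb_def)
  moreover have "lincomb c e F \<in> l2v S R"
    using insert by (intro l2v_lincomb) auto
  ultimately show ?case
    using insert l2v_inner_lin[OF _ _ h] by simp
qed

lemma l2v_inner_commute: "l2v_inner R f h = cnj (l2v_inner R h f)"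
  by (simp add: l2v_inner_def mult.commute flip: infsum_cnj)

text \<open>By the finite Parseval identity both Riesz inequalities are equalities with constant
  1.\<close>

lemma orthonormal_basis_imp_riesz_basis:
  assumes onb: "orthonormal_basis S R I e"
  shows "riesz_basis S R I e"
proof -
  have e: "e i \<in> l2v S R" if "i \<in> I" for i
    using onb that by (simp add: orthonormal_basis_def)
  have orth: "l2v_inner R (e i) (e k) = (if i = k then 1 else 0)" if "i \<in> I" "k \<in> I" for i k
    using onb that by (simp add: orthonormal_basis_def)
  have parseval: "(l2v_norm R (lincomb c e F))\<^sup>2 = (\<Sum>i\<in>F. (cmod (c i))\<^sup>2)" if F: "finite F" "F \<subseteq> I" for F c
  proof -
    let ?f = "lincomb c e F"
    have eF: "e i \<in> l2v S R" if "i \<in> F" for i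
      using that F e by auto
    have f: "?f \<in> l2v S R"
      by (rule l2v_lincomb[OF F(1) eF])
    have "l2v_inner R (e i) ?f = cnj (c i)" if i: "i \<in> F" for i
    proof -
      have "l2v_inner R ?f (e i) = (\<Sum>k\<in>F. if k = i then c k else 0)"
      proof -
        have "(\<Sum>k\<in>F. c k * l2v_inner R (e k) (e i)) = (\<Sum>k\<in>F. if k = i then c k else 0)"
          using F(2) i by (intro sum.cong) (auto simp: orth subsetD[OF F(2)])
        then show ?thesis
          by (simp add: l2v_inner_lincomb_left[OF F(1) eF eF[OF i]])
      qed
      then show ?thesis
        using F(1) i by (subst l2v_inner_commute) simp
    qed
    then have "l2v_inner R ?f ?f = (\<Sum>i\<in>F. of_real ((cmod (c i))\<^sup>2))"
      by (simp add: l2v_inner_lincomb_left[OF F(1) eF f] complex_norm_square del: of_real_power)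
    then show ?thesis
      by (simp add: l2v_norm_def sum_nonneg flip: of_real_sum)
  qed
  have "riesz_sequence S R I e"
    unfolding riesz_sequence_def
  proof (intro conjI exI[of _ "1 :: real"] allI impI ballI)
    show "e i \<in> l2v S R" if "i \<in> I" for i
      by (rule e[OF that])
  qed (auto simp: parseval)
  then show ?thesis
    using onb by (simp add: riesz_basis_def orthonormal_basis_def)
qed

section \<open>Algebraic span and density\<close>

definition in_span :: "'i set \<Rightarrow> ('i \<Rightarrow> vseq) \<Rightarrow> vseq \<Rightarrow> bool" where
  "in_span I e f \<longleftrightarrow> (\<exists>F c. finite F \<and> F \<subseteq> I \<and> f = lincomb c e F)"

lemma in_span_zero: "in_span I e (\<lambda>_ _. 0)"
  unfolding in_span_def by (intro exI[of _ "{}"]) (simp add: lincomb_def)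

lemma in_span_lin:
  assumes "in_span I e f" "in_span I e h"
  shows "in_span I e (\<lambda>r j. a * f r j + h r j)"
proof -
  have *: "\<exists>F b. finite F \<and> F \<subseteq> I \<and> (\<forall>i. i \<notin> F \<longrightarrow> b i = 0) \<and> f = lincomb b e F" if f: "in_span I e f" for f
  proof -
    obtain F c where F: "finite F" "F \<subseteq> I" "f = lincomb c e F"
      using f unfolding in_span_def by blast
    have "lincomb (\<lambda>i. if i \<in> F then c i else 0) e F = f"
      by (simp add: F(3) lincomb_def)
    then show ?thesis
      using F(1,2) by (intro exI[of _ F] exI[of _ "\<lambda>i. if i \<in> F then c i else 0"]) auto
  qed
  obtain F b where F: "finite F" "F \<subseteq> I" "\<And>i. i \<notin> F \<Longrightarrow> b i = 0" "f = lincomb b e F"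
    using *[OF assms(1)] by blast
  obtain F' b' where F': "finite F'" "F' \<subseteq> I" "\<And>i. i \<notin> F' \<Longrightarrow> b' i = 0" "h = lincomb b' e F'"
    using *[OF assms(2)] by blast
  have "(\<lambda>r j. a * f r j + h r j) = lincomb (\<lambda>i. a * b i + b' i) e (F \<union> F')"
    unfolding F(4) F'(4) by (rule lincomb_lin[symmetric]) (use F F' in auto)
  then show ?thesis
    unfolding in_span_def using F(1,2) F'(1,2)
    by (intro exI[of _ "F \<union> F'"] exI[of _ "\<lambda>i. a * b i + b' i"]) simp
qed

lemma in_span_lincomb:
  assumes "finite K" "\<And>k. k \<in> K \<Longrightarrow> in_span I e (u k)"
  shows "in_span I e (lincomb b u K)"
  using assms
proof (induction K)
  case empty
  then show ?case
    using in_span_zero by (simp add: lincomb_def)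
next
  case (insert k K)
  then show ?case
    using in_span_lin[of I e "u k" "lincomb b u K" "b k"] by (simp add: lincomb_def)
qed

text \<open>Finitely supported vectors are dense, so reaching each unit vector exactly by a finite
  combination is enough. The systems built from tilings do so.\<close>

lemma complete_familyI:
  assumes "\<And>j r. j \<in> S \<Longrightarrow> r \<in> {1..R} \<Longrightarrow> in_span I e (unit_vseq S (j, r))"
  shows "complete_family S R I e"
  unfolding complete_family_def
proof (intro ballI allI impI)
  fix f and \<epsilon> :: real assume f: "f \<in> l2v S R" and "\<epsilon> > 0"
  from l2v_restrict_approx[OF f \<open>\<epsilon> > 0\<close>] obtain J where J: "finite J"
    and "\<And>J'. finite J' \<Longrightarrow> J \<subseteq> J' \<Longrightarrow> l2v_norm R (\<lambda>r j. f r j - (if j \<in> J' then f r j else 0)) < \<epsilon>"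
    by blast
  from this(2)[of J] J have lt: "l2v_norm R (\<lambda>r j. f r j - (if j \<in> J then f r j else 0)) < \<epsilon>"
    by simp
  have "in_span I e (unit_vseq S (j, r))" if "r \<in> {1..R}" for j r
  proof (cases "j \<in> S")
    case False
    then have "unit_vseq S (j, r) = (\<lambda>_ _. 0)"
      by (auto simp: unit_vseq_def)
    then show ?thesis
      by (simp add: in_span_zero)
  qed (use that assms in blast)
  then have "in_span I e (lincomb (\<lambda>(j, r). f r j) (unit_vseq S) (J \<times> {1..R}))"
    using J by (intro in_span_lincomb) auto
  then obtain F c where F: "finite F" "F \<subseteq> I" "(\<lambda>r j. if j \<in> J then f r j else 0) = lincomb c e F"
    unfolding in_span_def restrict_eq_lincomb_unit_vseq[OF f J, symmetric] by blast
  have "(if j \<in> J then f r j else 0) = lincomb c e F r j" for r j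
    using fun_cong[OF fun_cong[OF F(3)]] by simp
  then show "\<exists>F c. finite F \<and> F \<subseteq> I \<and> l2v_norm R (\<lambda>r j. f r j - lincomb c e F r j) < \<epsilon>"
    using F(1,2) lt by (intro exI[of _ F] exI[of _ c]) simp
qed

section \<open>Gabor bases from tilings\<close>

text \<open>Two modulations of the same translate of a generator share the support \<open>G\<close>
  moved by \<open>c\<close>; this turns their inner product into a finite sum over
  \<open>G\<close>.\<close>

lemma sum_infsum_translate:
  fixes F :: "int \<Rightarrow> complex" and G :: "(int \<times> nat) set"
  assumes G: "finite G" "G \<subseteq> UNIV \<times> {1..R}"
  shows "(\<Sum>r=1..R. \<Sum>\<^sub>\<infinity>j. if (j - c, r) \<in> G then F j else 0) = (\<Sum>(j, r)\<in>G. F (j + c))"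
proof -
  have "(\<Sum>\<^sub>\<infinity>j. if (j - c, r) \<in> G then F j else 0) = (\<Sum>j\<in>fst ` G. if (j, r) \<in> G then F (j + c) else 0)" for r
  proof -
    have "(\<Sum>\<^sub>\<infinity>j. if (j - c, r) \<in> G then F j else 0) = (\<Sum>\<^sub>\<infinity>j\<in>(\<lambda>j. j + c) ` fst ` G. if (j - c, r) \<in> G then F j else 0)"
      by (rule infsum_cong_neutral) (force simp: image_iff)+
    also have "\<dots> = (\<Sum>j\<in>(\<lambda>j. j + c) ` fst ` G. if (j - c, r) \<in> G then F j else 0)"
      using G(1) by simp
    also have "\<dots> = (\<Sum>j\<in>fst ` G. if (j, r) \<in> G then F (j + c) else 0)"
      by (subst sum.reindex) (auto simp: inj_on_def)
    finally show ?thesis .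
  qed
  then have "(\<Sum>r=1..R. \<Sum>\<^sub>\<infinity>j. if (j - c, r) \<in> G then F j else 0) =
      (\<Sum>(j, r)\<in>fst ` G \<times> {1..R}. if (j, r) \<in> G then F (j + c) else 0)"
    by (simp add: sum.cartesian_product[symmetric] sum.swap[of _ "fst ` G"])
  also have "\<dots> = (\<Sum>(j, r)\<in>G. F (j + c))"
  proof (rule sum.mono_neutral_cong_right)
    show "G \<subseteq> fst ` G \<times> {1..R}"
      using G(2) by force
    show "finite (fst ` G \<times> {1..R})"
      using G(1) by (intro finite_cartesian_product finite_imageI) auto
  qed auto
  finally show ?thesis .
qed

text \<open>Elements with different (n, l) have disjoint supports. For equal (n, l) the support is a
  transversal of Z / M, on which the M characters are orthogonal; having M points, it is normalised
  by 1 / sqrt M. By Fourier inversion on the transversal every unit vector at a covered point lies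
  in the span.\<close>

lemma gabor_orthonormal_basis_of_tiling:
  fixes G :: "nat \<Rightarrow> (int \<times> nat) set"
  assumes M: "M > 0" and S: "periodic_set N S"
    and sub: "\<And>l. l < L \<Longrightarrow> G l \<subseteq> S \<times> {1..R}"
    and bij: "\<And>l. l < L \<Longrightarrow> bij_betw (\<lambda>(j, r). j mod int M) (G l) {0..<int M}"
    and cover: "\<And>j r. j \<in> S \<Longrightarrow> r \<in> {1..R} \<Longrightarrow> \<exists>n l. l < L \<and> (j - n * int N, r) \<in> G l"
    and disj: "\<And>j r n n' l l'. l < L \<Longrightarrow> l' < L \<Longrightarrow> (j - n * int N, r) \<in> G l \<Longrightarrow>
      (j - n' * int N, r) \<in> G l' \<Longrightarrow> n = n' \<and> l = l'"
  defines "g \<equiv> \<lambda>l r j. if (j, r) \<in> G l then 1 / complex_of_real (sqrt (real M)) else 0"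
  shows "\<forall>l<L. g l \<in> l2v S R" and "orthonormal_basis S R (gabor_index L M) (gabor g M N)"
proof -
  let ?I = "gabor_index L M" and ?e = "gabor g M N" and ?s = "complex_of_real (sqrt (real M))"
  have s: "?s * ?s = of_nat M"
    by (simp flip: of_real_mult)
  have fin: "finite (G l)" if "l < L" for l
    using bij_betw_finite[OF bij[OF that]] by simp
  have g: "g l \<in> l2v S R" if l: "l < L" for l
  proof (rule l2vI)
    show "(\<lambda>j. \<Sum>r=1..R. (cmod (g l r j))\<^sup>2) summable_on UNIV"
    proof (rule finite_nonzero_values_imp_summable_on, rule finite_subset)
      have "(\<Sum>r=1..R. (cmod (g l r j))\<^sup>2) = 0" if "j \<notin> fst ` G l" for j
      proof -
        have "g l r j = 0" for r
          using that by (force simp: g_def)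
        then show ?thesis
          by simp
      qed
      then show "{j \<in> UNIV. (\<Sum>r=1..R. (cmod (g l r j))\<^sup>2) \<noteq> 0} \<subseteq> fst ` G l"
        by blast
    qed (use fin[OF l] in simp)
  qed (use sub[OF l] in \<open>auto simp: g_def\<close>)
  then show "\<forall>l<L. g l \<in> l2v S R"
    by blast
  have orth: "l2v_inner R (?e i) (?e k) = (if i = k then 1 else 0)" if i: "i \<in> ?I" and k: "k \<in> ?I" for i k
  proof -
    obtain m n l where i_eq: "i = (m, n, l)" and m: "m < M" and l: "l < L"
      using i by (auto simp: gabor_index_def)
    obtain m' n' l' where k_eq: "k = (m', n', l')" and m': "m' < M" and l': "l' < L"
      using k by (auto simp: gabor_index_def)
    show ?thesis
    proof (cases "n = n' \<and> l = l'")
      case False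
      have z: "?e i r j * cnj (?e k r j) = 0" for r j
        using False disj[OF l l', of j n r n'] by (auto simp: i_eq k_eq gabor_apply g_def)
      have "l2v_inner R (?e i) (?e k) = 0"
        unfolding l2v_inner_def z by simp
      then show ?thesis
        using False by (auto simp: i_eq k_eq)
    next
      case True
      let ?x = "int m - int m'" and ?c = "n * int N"
      have "?e i r j * cnj (?e k r j) = (if (j - ?c, r) \<in> G l then chi M (?x * j) / of_nat M else 0)" for r j
        using True s by (auto simp: i_eq k_eq gabor_apply g_def cnj_chi left_diff_distrib chi_add[symmetric])
      then have "l2v_inner R (?e i) (?e k) = (\<Sum>(j, r)\<in>G l. chi M (?x * (j + ?c)) / of_nat M)"
        unfolding l2v_inner_def using sub[OF l] fin[OF l] by (subst sum_infsum_translate[symmetric]) auto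
      \<comment> \<open>The translation contributes only a constant phase. The remaining factor
        depends on \<open>j\<close> modulo \<open>M\<close>, so the transversal yields a full
        character sum.\<close>
      also have "\<dots> = (\<Sum>(j, r)\<in>G l. chi M (?x * (j mod int M))) * (chi M (?x * ?c) / of_nat M)"
      proof -
        have "chi M (?x * (j + ?c)) = chi M (?x * (j mod int M)) * chi M (?x * ?c)" for j
        proof -
          have "int M dvd ?x * (j + ?c) - (?x * (j mod int M) + ?x * ?c)"
            by (simp add: distrib_left right_diff_distrib[symmetric] minus_mod_eq_mult_div)
          then show ?thesis
            unfolding chi_add[symmetric] by (rule chi_cong[OF M])
        qed
        then show ?thesis
          by (simp add: sum_distrib_right sum_divide_distrib case_prod_unfold)
      qed
      also have "(\<Sum>(j, r)\<in>G l. chi M (?x * (j mod int M))) = (\<Sum>t\<in>{0..<int M}. chi M (?x * t))"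
        using sum.reindex_bij_betw[OF bij[OF l], of "\<lambda>t. chi M (?x * t)"] by (simp add: case_prod_unfold)
      also have "\<dots> = (\<Sum>t<M. chi M (int t * ?x))"
        by (rule sum.reindex_bij_witness[of _ int nat]) (auto simp: mult.commute)
      also have "\<dots> = (if m = m' then of_nat M else 0)"
      proof -
        have "int M dvd ?x \<longleftrightarrow> int m mod int M = int m' mod int M"
          by (rule mod_eq_dvd_iff[symmetric])
        also have "\<dots> \<longleftrightarrow> m = m'"
          using m m' by simp
        finally show ?thesis
          by (simp add: sum_chi[OF M])
      qed
      finally show ?thesis
        using True M by (auto simp: i_eq k_eq)
    qed
  qed
  have cpl: "complete_family S R ?I ?e"
  proof (rule complete_familyI)
    fix j r assume j: "j \<in> S" and r: "r \<in> {1..R}"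
    obtain n l where l: "l < L" and jr: "(j - n * int N, r) \<in> G l"
      using cover[OF j r] by blast
    \<comment> \<open>Coefficients of the inverse Fourier transform on Z / M: the two factors 1 /
      sqrt M, one here and one in \<open>g\<close>, cancel the value \<open>M\<close> of the
      character sum.\<close>
    let ?c = "\<lambda>(m, n, l). chi M (int m * - j) / ?s"
    have "unit_vseq S (j, r) = lincomb ?c ?e ((\<lambda>m. (m, n, l)) ` {..<M})"
    proof (intro ext)
      fix r' j'
      have "lincomb ?c ?e ((\<lambda>m. (m, n, l)) ` {..<M}) r' j' =
          (\<Sum>m<M. chi M (int m * - j) / ?s * (chi M (int m * j') * g l r' (j' - n * int N)))"
        unfolding lincomb_def by (subst sum.reindex) (auto simp: inj_on_def gabor_apply)
      also have "\<dots> = (\<Sum>m<M. chi M (int m * (j' - j))) * (g l r' (j' - n * int N) / ?s)"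
        unfolding sum_distrib_right
      proof (rule sum.cong[OF refl])
        fix m
        have "chi M (int m * (j' - j)) = chi M (int m * - j) * chi M (int m * j')"
          unfolding chi_add[symmetric] by (rule arg_cong[of _ _ "chi M"]) (simp add: algebra_simps)
        then show "chi M (int m * - j) / ?s * (chi M (int m * j') * g l r' (j' - n * int N)) =
            chi M (int m * (j' - j)) * (g l r' (j' - n * int N) / ?s)"
          by simp
      qed
      also have "\<dots> = (if int M dvd j' - j \<and> (j' - n * int N, r') \<in> G l then 1 else 0)"
        using M s by (auto simp: sum_chi[OF M] g_def)
      \<comment> \<open>The character sum keeps the points congruent to \<open>j\<close> modulo
        \<open>M\<close>, and the translated transversal contains just one of them.\<close>
      also have "int M dvd j' - j \<and> (j' - n * int N, r') \<in> G l \<longleftrightarrow> r' = r \<and> j' = j"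
      proof
        assume *: "int M dvd j' - j \<and> (j' - n * int N, r') \<in> G l"
        then have "int M dvd (j' - n * int N) - (j - n * int N)"
          by simp
        then have "(j' - n * int N) mod int M = (j - n * int N) mod int M"
          by (simp only: mod_eq_dvd_iff)
        then show "r' = r \<and> j' = j"
          using inj_onD[OF bij_betw_imp_inj_on[OF bij[OF l]], of "(j' - n * int N, r')" "(j - n * int N, r)"] * jr
          by simp
      qed (use jr in auto)
      also have "(if r' = r \<and> j' = j then 1 else 0) = unit_vseq S (j, r) r' j'"
        using j by (simp add: unit_vseq_def)
      finally show "unit_vseq S (j, r) r' j' = lincomb ?c ?e ((\<lambda>m. (m, n, l)) ` {..<M}) r' j'"
        by (rule sym)
    qed
    moreover have "(\<lambda>m. (m, n, l)) ` {..<M} \<subseteq> ?I"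
      using l by (auto simp: gabor_index_def)
    ultimately show "in_span ?I ?e (unit_vseq S (j, r))"
      unfolding in_span_def by (intro exI[of _ "(\<lambda>m. (m, n, l)) ` {..<M}"] exI[of _ ?c]) auto
  qed
  have "?e i \<in> l2v S R" if "i \<in> ?I" for i
    using that gabor_in_l2v[OF S g] by (auto simp: gabor_index_def)
  then show "orthonormal_basis S R ?I ?e"
    unfolding orthonormal_basis_def using orth cpl by blast
qed


text \<open>For fixed \<open>l\<close>, each (a, u) gives one point of the support, and
  \<open>\<beta> a\<close> chooses its orbit \<open>k\<close> and component \<open>r\<close>. The
  cardinality condition is exactly what permits each admissible (k, r) to be chosen by one and only
  one (u, l), so that the translates cover without overlap.\<close>

lemma card_imp_orthonormal_basis:
  fixes L M N R p q d :: nat and S :: "int set"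
  assumes pos: "p > 0" "q > 0" "d > 0" and pq: "coprime p q"
    and M: "M = q * d" and N: "N = p * d"
    and S: "periodic_set N S"
    and card: "\<And>a. a < d \<Longrightarrow> R * card (K_set S M p a) = q * L"
  shows "\<exists>g. (\<forall>l<L. g l \<in> l2v S R) \<and> orthonormal_basis S R (gabor_index L M) (gabor g M N)"
proof -
  have M0: "M > 0"
    using pos by (simp add: M)
  have fin: "finite (K_set S M p a)" for a
    by (simp add: K_set_def)
  have "\<exists>\<beta>. bij_betw \<beta> ({..<q} \<times> {..<L}) (K_set S M p a \<times> {1..R})" if "a < d" for a
    using card[OF that] fin by (intro finite_same_card_bij) (auto simp: card_cartesian_product mult.commute)
  then obtain \<beta> where \<beta>: "\<And>a. a < d \<Longrightarrow> bij_betw (\<beta> a) ({..<q} \<times> {..<L}) (K_set S M p a \<times> {1..R})"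
    by metis
  have \<beta>_mem: "fst (\<beta> a (u, l)) < p" "int a + int (fst (\<beta> a (u, l))) * int M \<in> S" "snd (\<beta> a (u, l)) \<in> {1..R}"
    if "a < d" "u < q" "l < L" for a u l
  proof -
    have "\<beta> a (u, l) \<in> K_set S M p a \<times> {1..R}"
      using bij_betwE[OF \<beta>[OF that(1)]] that by auto
    then show "fst (\<beta> a (u, l)) < p" "int a + int (fst (\<beta> a (u, l))) * int M \<in> S" "snd (\<beta> a (u, l)) \<in> {1..R}"
      by (auto simp: K_set_def mem_Times_iff)
  qed
  define pt where "pt l = (\<lambda>(a, u). (int a + int (fst (\<beta> a (u, l))) * int M + int u * int N, snd (\<beta> a (u, l))))" for l
  define G where "G l = pt l ` ({..<d} \<times> {..<q})" for l
  have GE: "\<exists>a u. a < d \<and> u < q \<and> j = int a + int (fst (\<beta> a (u, l))) * int M + int u * int N \<and> r = snd (\<beta> a (u, l))"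
    if "(j, r) \<in> G l" for j r l
    using that by (auto simp: G_def pt_def)

  have sub: "G l \<subseteq> S \<times> {1..R}" if l: "l < L" for l
    using \<beta>_mem[OF _ _ l] by (auto simp: G_def pt_def periodic_set_iff(1)[OF S])

  have bij: "bij_betw (\<lambda>(j, r). j mod int M) (G l) {0..<int M}" if l: "l < L" for l
  proof -
    let ?X = "{..<d} \<times> {..<q}" and ?m = "\<lambda>(j, r). j mod int M"
    \<comment> \<open>Since d divides M and N, the residue modulo d recovers \<open>a\<close>. Then
      the terms in \<open>k\<close> drop out modulo \<open>M\<close>, and cancelling d leaves u p
      modulo q, which recovers \<open>u\<close> as p is invertible modulo q.\<close>
    have inj: "inj_on (?m \<circ> pt l) ?X"
    proof (rule inj_onI, clarify)
      fix a u a' u'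
      assume a: "a < d" "a' < d" and u: "u < q" "u' < q"
        and eq: "(?m \<circ> pt l) (a, u) = (?m \<circ> pt l) (a', u')"
      let ?k = "int (fst (\<beta> a (u, l)))" and ?k' = "int (fst (\<beta> a' (u', l)))"
      have dvd: "int M dvd (int a + ?k * int M + int u * int N) - (int a' + ?k' * int M + int u' * int N)"
        using eq by (simp add: pt_def mod_eq_dvd_iff)
      have "(int a + ?k * int M + int u * int N) - (int a' + ?k' * int M + int u' * int N) =
          (int a - int a') + int d * ((?k - ?k') * int q + (int u - int u') * int p)"
        by (simp add: M N algebra_simps)
      moreover have "int d dvd int M"
        by (simp add: M)
      ultimately have "int d dvd (int a - int a') + int d * ((?k - ?k') * int q + (int u - int u') * int p)"
        using dvd by (metis dvd_trans)
      then have "int d dvd int a - int a'"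
        by (simp add: dvd_add_left_iff)
      then have "int a mod int d = int a' mod int d"
        by (simp add: mod_eq_dvd_iff)
      then have aa: "a = a'"
        using a by simp
      have "(int a + ?k * int M + int u * int N) - (int a' + ?k' * int M + int u' * int N) =
          (?k - ?k') * int M + (int u - int u') * int N"
        by (simp add: aa algebra_simps)
      then have "int M dvd (int u - int u') * int N"
        using dvd by (simp add: dvd_add_right_iff)
      then have "int d * int q dvd int d * ((int u - int u') * int p)"
        by (simp add: M N mult_ac)
      then have "int q dvd (int u - int u') * int p"
        using pos(3) by simp
      then have "int q dvd int u - int u'"
        using pq by (simp add: coprime_dvd_mult_left_iff coprime_commute)
      then have "int u mod int q = int u' mod int q"
        by (simp add: mod_eq_dvd_iff)
      then show "a = a' \<and> u = u'"
        using u aa by simp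
    qed
    \<comment> \<open>An injective image of d q = M pairs fills all M residues.\<close>
    have "(?m \<circ> pt l) ` ?X = {0..<int M}"
    proof (rule card_subset_eq)
      show "(?m \<circ> pt l) ` ?X \<subseteq> {0..<int M}"
        using M0 by (auto simp: pt_def)
      show "card ((?m \<circ> pt l) ` ?X) = card {0..<int M}"
        unfolding card_image[OF inj] by (simp add: M mult.commute nat_mult_distrib)
    qed simp
    moreover have "inj_on ?m (G l)"
      unfolding G_def by (rule inj_on_imageI[OF inj])
    ultimately show ?thesis
      unfolding bij_betw_def G_def by (simp add: image_comp)
  qed

  have cover: "\<exists>n l. l < L \<and> (j - n * int N, r) \<in> G l" if j: "j \<in> S" and r: "r \<in> {1..R}" for j r
  proof -
    define a where "a = nat (j mod int d)"
    have a: "a < d" "int a = j mod int d"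
      using pos(3) by (simp_all add: a_def nat_less_iff)
    then have "int d dvd j - int a"
      by (simp add: minus_mod_eq_mult_div)
    then obtain k n where k: "k < p" and "j = int a + int k * int (q * d) - n * int (p * d)"
      by (rule residue_decomposition_exists[OF pos(1) pq])
    then have jkn: "j = int a + int k * int M - n * int N"
      by (simp add: M N)
    then have "int a + int k * int M \<in> S"
      using j periodic_set_iff(2)[OF S, of "int a + int k * int M" n] by simp
    then have "(k, r) \<in> K_set S M p a \<times> {1..R}"
      using k r by (simp add: K_set_def)
    then have "(k, r) \<in> \<beta> a ` ({..<q} \<times> {..<L})"
      using bij_betw_imp_surj_on[OF \<beta>[OF a(1)]] by simp
    then obtain u l where ul: "u < q" "l < L" "\<beta> a (u, l) = (k, r)"
      by auto
    \<comment> \<open>The point of the support differs from a + k M by u N, whereas \<open>j\<close>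
      differs from it by - n N; the translation has to make up both.\<close>
    have "(j - (- n - int u) * int N, r) = pt l (a, u)"
      by (simp add: pt_def ul(3) jkn algebra_simps)
    then have "(j - (- n - int u) * int N, r) \<in> G l"
      unfolding G_def using a(1) ul(1) by simp
    then show ?thesis
      using ul(2) by blast
  qed

  have disj: "n = n' \<and> l = l'"
    if l: "l < L" "l' < L" and jr: "(j - n * int N, r) \<in> G l" "(j - n' * int N, r) \<in> G l'" for j r n n' l l'
  proof -
    obtain a u where a: "a < d" and u: "u < q"
      and j: "j - n * int N = int a + int (fst (\<beta> a (u, l))) * int M + int u * int N" and r: "r = snd (\<beta> a (u, l))"
      using GE[OF jr(1)] by blast
    obtain a' u' where a': "a' < d" and u': "u' < q"
      and j': "j - n' * int N = int a' + int (fst (\<beta> a' (u', l'))) * int M + int u' * int N" and r': "r = snd (\<beta> a' (u', l'))"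
      using GE[OF jr(2)] by blast
    let ?k = "fst (\<beta> a (u, l))" and ?k' = "fst (\<beta> a' (u', l'))"
    have eq: "int a + int ?k * int M - (- n - int u) * int N = int a' + int ?k' * int M - (- n' - int u') * int N"
      using j j' by (simp add: algebra_simps)
    have "int a - int a' = int d * ((int ?k' - int ?k) * int q + (n' + int u' - n - int u) * int p)"
      using eq by (simp add: M N algebra_simps)
    then have "int d dvd int a - int a'"
      by simp
    then have "int a mod int d = int a' mod int d"
      by (simp add: mod_eq_dvd_iff)
    then have aa: "a' = a"
      using a a' by simp
    \<comment> \<open>Only the combination n + u is determined by the orbit. Injectivity of
      \<open>\<beta> a\<close>, applied to the common pair (k, r), then separates \<open>u\<close>
      and \<open>l\<close>, and hence \<open>n\<close>.\<close>
    have "?k = ?k' \<and> - n - int u = - n' - int u'"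
      by (rule residue_decomposition_unique[OF pos(1,3) pq])
        (use eq \<beta>_mem(1)[OF a u l(1)] \<beta>_mem(1)[OF a' u' l(2)] in \<open>simp_all add: aa M N\<close>)
    moreover from this r r' have "\<beta> a (u, l) = \<beta> a (u', l')"
      by (simp add: aa prod_eq_iff)
    then have "(u, l) = (u', l')"
      by (rule inj_onD[OF bij_betw_imp_inj_on[OF \<beta>[OF a]]]) (use u u' l in auto)
    ultimately show ?thesis
      by simp
  qed

  show ?thesis
  proof (intro exI conjI)
    let ?g = "\<lambda>l r j. if (j, r) \<in> G l then 1 / complex_of_real (sqrt (real M)) else 0"
    show "\<forall>l<L. ?g l \<in> l2v S R"
      by (rule gabor_orthonormal_basis_of_tiling(1)[OF M0 S]; (rule sub bij cover disj; assumption))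
    show "orthonormal_basis S R (gabor_index L M) (gabor ?g M N)"
      by (rule gabor_orthonormal_basis_of_tiling(2)[OF M0 S]; (rule sub bij cover disj; assumption))
  qed
qed

theorem theorem4p8:
  fixes L M N R p q :: nat and S :: "int set"
  assumes "L \<ge> 1" "M \<ge> 1" "N \<ge> 1" "R \<ge> 1" "p \<ge> 1" "q \<ge> 1"
    and "coprime p q"
    and "real N / real M = real p / real q"
    and "periodic_set N S"
  shows "((\<exists>g. (\<forall>l<L. g l \<in> l2v S R) \<and>
              orthonormal_basis S R (gabor_index L M) (gabor g M N))
          \<longleftrightarrow>
          (\<exists>g. (\<forall>l<L. g l \<in> l2v S R) \<and>
              riesz_basis S R (gabor_index L M) (gabor g M N)))
       \<and> ((\<exists>g. (\<forall>l<L. g l \<in> l2v S R) \<and>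
              riesz_basis S R (gabor_index L M) (gabor g M N))
          \<longleftrightarrow>
          (\<forall>j < M div q. R * card (K_set S M p j) = q * L))"
proof -
  have "q dvd M"
    using assms by (intro q_dvd_M[of M q p N]) auto
  then have M: "M = q * (M div q)"
    by simp
  have "real (N * q) = real (p * M)"
    using assms by (simp add: field_simps)
  then have "N * q = p * M"
    by (simp only: of_nat_eq_iff)
  also have "\<dots> = (p * (M div q)) * q"
    using M by (metis mult.assoc mult.commute)
  finally have N: "N = p * (M div q)"
    using assms(6) by simp
  have pos: "M > 0" "N > 0" "p > 0" "q > 0" "M div q > 0"
    using assms(2,3,5,6) N by (auto intro: Nat.gr0I)
  \<comment> \<open>With d = \<open>M div q\<close>, the equivalences are closed as the cycle (1) =>
    (2) => (3) => (1).\<close>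
  have onb_riesz: "riesz_basis S R (gabor_index L M) (gabor g M N)"
    if "orthonormal_basis S R (gabor_index L M) (gabor g M N)" for g
    by (rule orthonormal_basis_imp_riesz_basis[OF that])
  have riesz_card: "\<forall>j < M div q. R * card (K_set S M p j) = q * L"
    if "\<forall>l<L. g l \<in> l2v S R" "riesz_basis S R (gabor_index L M) (gabor g M N)" for g
    using riesz_basis_imp_card[OF pos(1-4) assms(7) M N assms(9) _ that(2)] that(1) by simp
  have card_onb: "\<exists>g. (\<forall>l<L. g l \<in> l2v S R) \<and> orthonormal_basis S R (gabor_index L M) (gabor g M N)"
    if "\<forall>j < M div q. R * card (K_set S M p j) = q * L"
    using card_imp_orthonormal_basis[OF pos(3,4,5) assms(7) M N assms(9)] that by simp
  show ?thesis
    using onb_riesz riesz_card card_onb by blast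
qed

end
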